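(* Let $d\ge2$, let $\mathbf e$ be a fixed unit vector of $\mathbb R^d$, and let $K\subset\mathbb R^d$ be a compact non-polar set with $\mathbb R^d\setminus\Omega_K=K^r$. Suppose that $$\mathrm{vol}_{d-1}\Big(\overline{\text{dis-ct}_{\mathbf e}(K)}\Big)=0 .$$ Then, for scalars $x>0$, as $x/t\to\infty$ and $t\to\infty$, $$E_0\big[\mathrm{vol}_d(S_K(t))\,\big|\,B_t=x\mathbf e\big]=\mathrm{vol}_{d-1}(\mathrm{pr}_{\mathbf e}K)\,x+o(x).$$
   Context: $B_t$ is a standard Brownian motion in $\mathbb R^d$, $P_y,E_y$ its law and expectation when started at $y$; conditioning on $B_t=x\mathbf e$ refers to the Brownian bridge from $0$ to $x\mathbf e$ of length $t$. $\sigma_D=\inf\{t>0:B_t\in D\}$. $K$ is non-polar if $P_y[\sigma_K<\infty]>0$ for some $y$; $K^r=\{y\in K:P_y[\sigma_K=0]=1\}$; $\Omega_K=\{y:P_y[\sigma_{\partial U(R)}<\sigma_K]>0\}$ for any $R$ with $K\subset U(R)$, $U(R)$ the open ball of radius $R$ about the origin. $S_K(t)=\{z:z-B_s\in K\text{ for some }s\in[0,t)\}$ is the Wiener sausage. $\Delta_{\mathbf e}$ is the hyperplane through the origin perpendicular to $\mathbf e$ (identified with $\mathbb R^{d-1}$), $\mathrm{pr}_{\mathbf e}$ the orthogonal projection onto it, $\mathrm{vol}_{d-1}$ the $(d-1)$-dimensional volume, $\mathrm{int}$ and $\partial_{d-1}$ interior and boundary relative to $\Delta_{\mathbf e}$.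 $h(z)=\sup\{s\in\mathbb R:z+s\mathbf e\in K\}$ for $z\in\Delta_{\mathbf e}$ ($\sup\emptyset=-\infty$), and $\text{dis-ct}_{\mathbf e}(K)=\{z\in\mathrm{int}(\mathrm{pr}_{\mathbf e}K):h\text{ is discontinuous at }z\}\cup\partial_{d-1}(\mathrm{pr}_{\mathbf e}K)$. *)

theory Defs
  imports "HOL-Probability.Probability" "HOL-Library.Landau_Symbols"
begin

section \<open>Brownian motion and Brownian bridge\<close>

definition heat_kernel :: "real \<Rightarrow> 'a::euclidean_space \<Rightarrow> real" where
  "heat_kernel t z = (2 * pi * t) powr (- real DIM('a) / 2) * exp (- (norm z)\<^sup>2 / (2 * t))"

text \<open>All paths are continuous; the starting point is only prescribed almost surely, so that one
  process can be a Brownian motion from different points under different laws.\<close>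

definition brownian_motion ::
    "'w measure \<Rightarrow> (real \<Rightarrow> 'w \<Rightarrow> 'a::euclidean_space) \<Rightarrow> 'a \<Rightarrow> bool" where
  "brownian_motion M B y \<longleftrightarrow>
     prob_space M \<and>
     (\<forall>t\<ge>0. B t \<in> borel_measurable M) \<and>
     (\<forall>\<omega>\<in>space M. continuous_on {0..} (\<lambda>t. B t \<omega>)) \<and>
     (AE \<omega> in M. B 0 \<omega> = y) \<and>
     (\<forall>(n::nat) s. 0 \<le> s 0 \<and> mono s \<longrightarrow>
        prob_space.indep_vars M (\<lambda>_. borel) (\<lambda>i \<omega>. B (s (Suc i)) \<omega> - B (s i) \<omega>) {..<n}) \<and>
     (\<forall>s t. 0 \<le> s \<and> s < t \<longrightarrow>
        distributed M lborel (\<lambda>\<omega>. B t \<omega> - B s \<omega>) (\<lambda>z. ennreal (heat_kernel (t - s) z)))"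

text \<open>\<open>X\<close> on \<open>[0, T]\<close> is a Brownian bridge from \<open>a\<close> to \<open>b\<close> of length \<open>T\<close>. The density of
  \<open>(X (s 1), \<dots>, X (s n))\<close>, where \<open>0 = s 0 < s 1 < \<dots> < s n < s (n + 1) = T\<close>, is the conditional
  density of \<open>(B (s 1), \<dots>, B (s n))\<close> given \<open>B T = b\<close> for a Brownian motion \<open>B\<close> from \<open>a\<close>.\<close>

definition brownian_bridge ::
    "'w measure \<Rightarrow> (real \<Rightarrow> 'w \<Rightarrow> 'a::euclidean_space) \<Rightarrow> 'a \<Rightarrow> 'a \<Rightarrow> real \<Rightarrow> bool" where
  "brownian_bridge M X a b T \<longleftrightarrow>
     prob_space M \<and>
     (\<forall>t\<in>{0..T}. X t \<in> borel_measurable M) \<and>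
     (\<forall>\<omega>\<in>space M. continuous_on {0..T} (\<lambda>t. X t \<omega>)) \<and>
     (AE \<omega> in M. X 0 \<omega> = a) \<and>
     (AE \<omega> in M. X T \<omega> = b) \<and>
     (\<forall>(n::nat) s. s 0 = 0 \<and> s (Suc n) = T \<and> (\<forall>i\<le>n. s i < s (Suc i)) \<longrightarrow>
        distributed M (\<Pi>\<^sub>M i\<in>{1..n}. lborel) (\<lambda>\<omega>. \<lambda>i\<in>{1..n}. X (s i) \<omega>)
          (\<lambda>x. let x' = x(0 := a, Suc n := b) in
             ennreal ((\<Prod>i\<le>n. heat_kernel (s (Suc i) - s i) (x' (Suc i) - x' i))
                        / heat_kernel T (b - a))))"

section \<open>Hitting times and associated sets\<close>

definition hitting_time :: "'a set \<Rightarrow> (real \<Rightarrow> 'a) \<Rightarrow> ereal" where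
  "hitting_time D \<beta> = Inf (ereal ` {t. 0 < t \<and> \<beta> t \<in> D})"

text \<open>In the following definitions \<open>P y\<close> is meant to be a law under which the process \<open>B\<close> is a
  Brownian motion started at \<open>y\<close>.\<close>

definition non_polar ::
    "('a \<Rightarrow> 'w measure) \<Rightarrow> (real \<Rightarrow> 'w \<Rightarrow> 'a::euclidean_space) \<Rightarrow> 'a set \<Rightarrow> bool" where
  "non_polar P B K \<longleftrightarrow> (\<exists>y. \<P>(\<omega> in P y. hitting_time K (\<lambda>t. B t \<omega>) < \<infinity>) > 0)"

definition regular_points ::
    "('a \<Rightarrow> 'w measure) \<Rightarrow> (real \<Rightarrow> 'w \<Rightarrow> 'a::euclidean_space) \<Rightarrow> 'a set \<Rightarrow> 'a set" where
  "regular_points P B K = {y \<in> K. \<P>(\<omega> in P y. hitting_time K (\<lambda>t. B t \<omega>) = 0) = 1}"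

text \<open>The set below is the same for every single radius \<open>R\<close> with \<open>K \<subseteq> ball 0 R\<close>.\<close>

definition Omega_set ::
    "('a \<Rightarrow> 'w measure) \<Rightarrow> (real \<Rightarrow> 'w \<Rightarrow> 'a::euclidean_space) \<Rightarrow> 'a set \<Rightarrow> 'a set" where
  "Omega_set P B K = {y. \<forall>R>0. K \<subseteq> ball 0 R \<longrightarrow>
     \<P>(\<omega> in P y. hitting_time (frontier (ball 0 R)) (\<lambda>t. B t \<omega>)
                     < hitting_time K (\<lambda>t. B t \<omega>)) > 0}"

definition wiener_sausage :: "'a::euclidean_space set \<Rightarrow> (real \<Rightarrow> 'a) \<Rightarrow> real \<Rightarrow> 'a set" where
  "wiener_sausage K \<beta> t = {z. \<exists>s\<in>{0..<t}. z - \<beta> s \<in> K}"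

section \<open>The hyperplane perpendicular to a unit vector\<close>

definition perp_hyperplane :: "'a::euclidean_space \<Rightarrow> 'a set" where
  "perp_hyperplane e = {z. z \<bullet> e = 0}"

definition perp_proj :: "'a::euclidean_space \<Rightarrow> 'a \<Rightarrow> 'a" where
  "perp_proj e z = z - (z \<bullet> e) *\<^sub>R e"

definition is_perp_basis :: "'a::euclidean_space \<Rightarrow> 'a set \<Rightarrow> bool" where
  "is_perp_basis e b \<longleftrightarrow> b \<subseteq> perp_hyperplane e \<and> pairwise orthogonal b \<and>
     (\<forall>u\<in>b. norm u = 1) \<and> span b = perp_hyperplane e"

lemma ex_perp_basis: "\<exists>b. is_perp_basis e b"
proof -
  have "subspace (perp_hyperplane e)"
    unfolding perp_hyperplane_def by (simp add: subspace_def inner_add_left)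
  from orthonormal_basis_subspace[OF this] show ?thesis
    unfolding is_perp_basis_def by metis
qed

text \<open>Lebesgue measure of the hyperplane, transported from the coordinates with respect to an
  orthonormal basis as in the definition of \<open>lborel\<close>. It does not depend on the
  chosen basis.\<close>

definition perp_lborel :: "'a::euclidean_space \<Rightarrow> 'a measure" where
  "perp_lborel e = (let b = (SOME b. is_perp_basis e b) in
     distr (\<Pi>\<^sub>M u\<in>b. lborel) borel (\<lambda>f. \<Sum>u\<in>b. f u *\<^sub>R u))"

definition upper_height :: "'a::euclidean_space \<Rightarrow> 'a set \<Rightarrow> 'a \<Rightarrow> ereal" where
  "upper_height e K z = Sup (ereal ` {s. z + s *\<^sub>R e \<in> K})"

definition dis_ct :: "'a::euclidean_space \<Rightarrow> 'a set \<Rightarrow> 'a set" where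
  "dis_ct e K =
     {z \<in> top_of_set (perp_hyperplane e) interior_of (perp_proj e ` K).
        \<not> continuous (at z within perp_hyperplane e) (upper_height e K)} \<union>
     top_of_set (perp_hyperplane e) frontier_of (perp_proj e ` K)"

end

theory Submission
  imports Defs
begin

text \<open>
  Cut the time interval into pieces during which the drift \<open>x / t\<close> carries the bridge over a
  distance of about a large constant \<open>L\<close>. As \<open>x / t \<rightarrow> \<infinity>\<close> the pieces have duration tending to
  \<open>0\<close>, so on a typical piece the path is uniformly close to a straight segment parallel to \<open>e\<close>, and
  the sausage of the piece is close to a cylinder of length \<open>L\<close> over \<open>perp_proj e ` K\<close>.

  From above, the volume of the sausage is at most the sum of the volumes of its pieces, and the
  contribution of the atypical pieces is controlled by a high moment of the fluctuation.

  From below, let \<open>y\<close> be a point of the projection near which the upper height of \<open>K\<close> is finite and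
  continuous. By the intermediate value theorem a nearly straight path sweeps the upper surface of
  \<open>K\<close> over the whole line above \<open>y\<close>, and by the hypothesis on \<open>dis_ct e K\<close> almost every point of the
  projection is of this kind. The cylinders swept by the pieces number \<open>i\<close> and \<open>j\<close> can only meet if the
  path deviates from its drift between them by at least \<open>\<bar>i - j\<bar>\<close>, so the overlaps in the Bonferroni
  inequality are negligible by a moment bound that is summable in \<open>\<bar>i - j\<bar>\<close>.
\<close>

section \<open>The heat kernel and increments of the bridge\<close>

text \<open>Each piece is judged by one number, its chaining sum. It dominates the supremum of the
  fluctuation, and its expectation needs only moments of increments, which follow from the joint
  density of the bridge at two times. The order 2d of the moments serves three ends. The sausage of
  a wild piece fits into a ball of radius proportional to the fluctuation r, and r^d is at most a
  constant times r^(2d) once r exceeds a fixed threshold. The moment of an increment over time u is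
  of order u^d with d >= 2, so the chaining series converges. Divided by the 2d-th power of the lag
  m, the moment of a deviation over m pieces decays like m^(-d). With N of order x / L pieces of
  duration \<delta>, the fluctuations cost N times a constant times the d-th power of \<delta>, and
  \<delta> tends to 0. The error 2 (R + 1) in the length of each cylinder does not shrink with
  \<delta>; only a large L makes it relatively small. Hence the order of the choices: the margin
  \<epsilon>, then L, then a lower bound on x / t that depends on both.\<close>

lemma heat_kernel_pos: "t > 0 \<Longrightarrow> heat_kernel t z > 0"
  by (simp add: heat_kernel_def)

lemma heat_kernel_nonneg [simp]: "heat_kernel t z \<ge> 0"
  by (simp add: heat_kernel_def)

lemma borel_measurable_heat_kernel [measurable]: "heat_kernel t \<in> borel_measurable borel"
  unfolding heat_kernel_def by measurable

text \<open>Pythagoras splits the exponent. An arbitrary orthonormal basis is allowed because the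
  same product form has to hold in the standard basis and in one that contains
  \<open>e\<close>.\<close>

lemma heat_kernel_orthonormal_sum:
  fixes b :: "'a::euclidean_space set"
  assumes "t > 0" and b: "finite b" "card b = DIM('a)" "pairwise orthogonal b" "\<forall>u\<in>b. norm u = 1"
  shows "heat_kernel t (\<Sum>u\<in>b. f u *\<^sub>R u) = (\<Prod>u\<in>b. normal_density 0 (sqrt t) (f u))"
proof -
  have pw: "pairwise (\<lambda>i j. orthogonal (f i *\<^sub>R i) (f j *\<^sub>R j)) b"
    using b(3) by (auto simp: pairwise_def orthogonal_def)
  have "(norm (\<Sum>u\<in>b. f u *\<^sub>R u))\<^sup>2 = (\<Sum>u\<in>b. (norm (f u *\<^sub>R u))\<^sup>2)"
    by (rule norm_sum_Pythagorean[OF b(1) pw])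
  also have "\<dots> = (\<Sum>u\<in>b. (f u)\<^sup>2)"
    using b(4) by (intro sum.cong) auto
  finally have n: "(norm (\<Sum>u\<in>b. f u *\<^sub>R u))\<^sup>2 = (\<Sum>u\<in>b. (f u)\<^sup>2)" .
  have "(2 * pi * t) powr (- real DIM('a) / 2) = ((2 * pi * t) powr (- 1 / 2)) powr real DIM('a)"
    by (simp add: powr_powr)
  also have "\<dots> = ((2 * pi * t) powr (- 1 / 2)) ^ DIM('a)"
    using \<open>t > 0\<close> by (simp add: powr_realpow)
  also have "(2 * pi * t) powr (- 1 / 2) = 1 / sqrt (2 * pi * t)"
    using \<open>t > 0\<close> powr_minus_divide[of "2 * pi * t" "1/2"] by (simp add: powr_half_sqrt)
  finally have p: "(2 * pi * t) powr (- real DIM('a) / 2) = (1 / sqrt (2 * pi * t)) ^ card b"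
    using b(2) by simp
  show ?thesis
    unfolding heat_kernel_def normal_density_def n p prod.distrib
    using \<open>t > 0\<close> b(1) by (simp add: sum_divide_distrib sum_negf flip: exp_sum)
qed

lemma prod_normal_density_nn_integral:
  assumes "finite b" "t > 0"
  shows "(\<integral>\<^sup>+f. ennreal (\<Prod>u\<in>b. normal_density 0 (sqrt t) (f u)) \<partial>(\<Pi>\<^sub>M u\<in>b. lborel)) = 1"
proof -
  interpret product_sigma_finite "\<lambda>_. lborel :: real measure"
    by standard
  have "(\<integral>\<^sup>+x. ennreal (normal_density 0 (sqrt t) x) \<partial>lborel) = 1"
    using \<open>t > 0\<close> by (subst nn_integral_eq_integral) auto
  then show ?thesis
    using assms product_nn_integral_prod[of b "\<lambda>_ x. ennreal (normal_density 0 (sqrt t) x)"]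
    by (simp add: prod_ennreal)
qed

lemma heat_kernel_nn_integral:
  assumes "t > 0"
  shows "(\<integral>\<^sup>+z. ennreal (heat_kernel t (z::'a::euclidean_space)) \<partial>lborel) = 1"
proof -
  have *: "heat_kernel t (\<Sum>u\<in>Basis. f u *\<^sub>R u) = (\<Prod>u\<in>(Basis::'a set). normal_density 0 (sqrt t) (f u))" for f
    using assms by (intro heat_kernel_orthonormal_sum) (auto simp: pairwise_def orthogonal_def inner_Basis)
  show ?thesis
    unfolding lborel_def[where 'a='a] lborel_eq_real[symmetric] using assms
    by (subst nn_integral_distr) (simp_all add: * prod_normal_density_nn_integral)
qed

text \<open>Completing the square. The second factor on the right is the density at time
  \<open>s\<close> of the bridge from 0 to \<open>c\<close> of length \<open>s + q\<close>, with
  mean \<open>(s / (s + q)) *\<^sub>R c\<close> and variance \<open>s * q / (s + q)\<close> in each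
  coordinate.\<close>

lemma heat_kernel_mult:
  fixes x c :: "'a::euclidean_space"
  assumes "s > 0" "q > 0"
  shows "heat_kernel s x * heat_kernel q (c - x) =
    heat_kernel (s + q) c * heat_kernel (s * q / (s + q)) (x - (s / (s + q)) *\<^sub>R c)"
proof -
  have n: "(norm x)\<^sup>2 / (2 * s) + (norm (c - x))\<^sup>2 / (2 * q) =
      (norm c)\<^sup>2 / (2 * (s + q)) + (norm (x - (s / (s + q)) *\<^sub>R c))\<^sup>2 / (2 * (s * q / (s + q)))"
    (is "?L = ?R")
  proof -
    define X Y C where "X = x \<bullet> x" and "Y = x \<bullet> c" and "C = c \<bullet> c"
    have pos: "s + q > 0" using assms by simp
    have "?L = X / (2 * s) + (C - 2 * Y + X) / (2 * q)"
      unfolding X_def Y_def C_def power2_norm_eq_inner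
      by (simp add: inner_diff_left inner_diff_right inner_commute algebra_simps)
    moreover have "?R = C / (2 * (s + q)) +
        (X - 2 * (s / (s + q)) * Y + (s / (s + q))\<^sup>2 * C) / (2 * (s * q / (s + q)))"
      unfolding X_def Y_def C_def power2_norm_eq_inner
      by (simp add: inner_diff_left inner_diff_right inner_commute algebra_simps power2_eq_square)
    moreover have "X / (2 * s) + (C - 2 * Y + X) / (2 * q) = C / (2 * (s + q)) +
        (X - 2 * (s / (s + q)) * Y + (s / (s + q))\<^sup>2 * C) / (2 * (s * q / (s + q)))"
      using assms pos by (simp add: divide_simps power2_eq_square) algebra
    ultimately show ?thesis by simp
  qed
  have "(2 * pi * s) * (2 * pi * q) = (2 * pi * (s + q)) * (2 * pi * (s * q / (s + q)))"
    using assms by (simp add: field_simps)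
  then have "(2 * pi * s) powr a * (2 * pi * q) powr a =
      (2 * pi * (s + q)) powr a * (2 * pi * (s * q / (s + q))) powr a" for a
    using assms by (simp only: powr_mult[symmetric])
  moreover have "exp (- (norm x)\<^sup>2 / (2 * s)) * exp (- (norm (c - x))\<^sup>2 / (2 * q)) =
      exp (- (norm c)\<^sup>2 / (2 * (s + q))) *
      exp (- (norm (x - (s / (s + q)) *\<^sub>R c))\<^sup>2 / (2 * (s * q / (s + q))))"
    using n by (simp add: mult_exp_exp del: times_divide_eq_right divide_divide_eq_right)
  moreover have aux: "A * E * (B * F) = C * G * (D * H)" if "A * B = C * D" "E * F = G * H"
    for A B C D E F G H :: real
    using that by algebra
  ultimately show ?thesis
    unfolding heat_kernel_def by (intro aux)
qed

lemma nn_integral_lborel_translation: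
  fixes g :: "'a::euclidean_space \<Rightarrow> ennreal"
  assumes [measurable]: "g \<in> borel_measurable borel"
  shows "(\<integral>\<^sup>+x. g (x + c) \<partial>lborel) = (\<integral>\<^sup>+x. g x \<partial>lborel)"
proof -
  have "(\<integral>\<^sup>+x. g x \<partial>lborel) = (\<integral>\<^sup>+x. g x \<partial>distr lborel borel (\<lambda>x. c + x))"
    by (simp add: lborel_distr_plus)
  also have "\<dots> = (\<integral>\<^sup>+x. g (x + c) \<partial>lborel)"
    by (subst nn_integral_distr) (auto simp: add.commute)
  finally show ?thesis ..
qed

lemma heat_kernel_convolution:
  fixes c :: "'a::euclidean_space"
  assumes "s > 0" "q > 0"
  shows "(\<integral>\<^sup>+x. ennreal (heat_kernel s x * heat_kernel q (c - x)) \<partial>lborel) = ennreal (heat_kernel (s + q) c)"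
proof -
  have "(\<integral>\<^sup>+x. ennreal (heat_kernel s x * heat_kernel q (c - x)) \<partial>lborel) =
      ennreal (heat_kernel (s + q) c) *
      (\<integral>\<^sup>+x. ennreal (heat_kernel (s * q / (s + q)) (x + - (s / (s + q)) *\<^sub>R c)) \<partial>lborel)"
    unfolding heat_kernel_mult[OF assms] by (simp add: ennreal_mult nn_integral_cmult)
  also have "\<dots> = ennreal (heat_kernel (s + q) c)"
    using assms heat_kernel_nn_integral[of "s * q / (s + q)", where 'a='a]
    by (subst nn_integral_lborel_translation[where g="\<lambda>x. ennreal (heat_kernel (s * q / (s + q)) x)"]) auto
  finally show ?thesis .
qed

definition gaussian_moment_const :: "'a::euclidean_space itself \<Rightarrow> nat \<Rightarrow> real" where
  "gaussian_moment_const _ q = fact q * 4 ^ q * 2 powr (real DIM('a) / 2)"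

text \<open>With \<open>u = |z|^2 / (4 * s)\<close>, the bound \<open>u^q <= q! * exp u\<close> pays
  for the power with half of the Gaussian exponent. What remains is the kernel of variance
  \<open>2 * s\<close>; the ratio of the normalisations is the factor \<open>2 powr (d / 2)\<close>
  of the constant.\<close>

lemma heat_kernel_moment:
  assumes "s > 0"
  shows "(\<integral>\<^sup>+z. ennreal (norm z ^ (2 * q) * heat_kernel s (z::'a::euclidean_space)) \<partial>lborel)
    \<le> ennreal (gaussian_moment_const TYPE('a) q * s ^ q)"
proof -
  have bound: "norm z ^ (2 * q) * heat_kernel s z
      \<le> gaussian_moment_const TYPE('a) q * s ^ q * heat_kernel (2 * s) z" for z :: 'a
  proof -
    define u where "u = (norm z)\<^sup>2 / (4 * s)"
    have "u \<ge> 0" using assms by (simp add: u_def)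
    then have "u ^ q / fact q \<le> exp u"
      using sum_le_suminf[OF summable_exp_generic[of u], of "{q}"]
      by (simp add: exp_def divide_inverse mult.commute)
    then have "u ^ q \<le> fact q * exp u" by (simp add: field_simps)
    moreover have "norm z ^ (2 * q) = 4 ^ q * s ^ q * u ^ q"
      using assms by (simp add: u_def power_mult power_divide power_mult_distrib)
    ultimately have 1: "norm z ^ (2 * q) \<le> 4 ^ q * s ^ q * (fact q * exp u)"
      using assms by (simp add: mult_left_mono)
    have "(2 * pi * s) powr a = 2 powr (- a) * (2 * pi * (2 * s)) powr a" for a
    proof -
      have "2 * pi * (2 * s) = 2 * (2 * pi * s)" by simp
      then have "(2 * pi * (2 * s)) powr a = 2 powr a * (2 * pi * s) powr a"
        using assms by (simp only: powr_mult)
      then show ?thesis by (simp add: powr_minus)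
    qed
    moreover have "exp (- (norm z)\<^sup>2 / (2 * s)) * exp u = exp (- (norm z)\<^sup>2 / (2 * (2 * s)))"
      using assms by (simp add: u_def mult_exp_exp field_simps)
    ultimately have 2: "exp u * heat_kernel s z = 2 powr (real DIM('a) / 2) * heat_kernel (2 * s) z"
      unfolding heat_kernel_def by (simp add: mult.assoc mult.left_commute mult.commute)
    have "norm z ^ (2 * q) * heat_kernel s z \<le> 4 ^ q * s ^ q * (fact q * exp u) * heat_kernel s z"
      by (intro mult_right_mono 1) simp
    also have "\<dots> = gaussian_moment_const TYPE('a) q * s ^ q * heat_kernel (2 * s) z"
      using 2 by (simp add: gaussian_moment_const_def mult.assoc mult.left_commute)
    finally show ?thesis .
  qed
  have "(\<integral>\<^sup>+z. ennreal (norm z ^ (2 * q) * heat_kernel s (z::'a)) \<partial>lborel)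
      \<le> (\<integral>\<^sup>+z. ennreal (gaussian_moment_const TYPE('a) q * s ^ q) * ennreal (heat_kernel (2 * s) (z::'a)) \<partial>lborel)"
    using bound assms
    by (intro nn_integral_mono) (simp add: ennreal_mult[symmetric] gaussian_moment_const_def ennreal_leI)
  also have "\<dots> = ennreal (gaussian_moment_const TYPE('a) q * s ^ q)"
    using assms by (simp add: nn_integral_cmult heat_kernel_nn_integral)
  finally show ?thesis .
qed

text \<open>The increment over time \<open>u = r - s\<close> is Gaussian with mean
  \<open>(u / T) b\<close> and variance \<open>u * (T - u) / T\<close>, which is at most
  \<open>u\<close>. Integrating out the position at time \<open>s\<close> by the convolution
  identity leaves \<open>heat_kernel u w * heat_kernel (T - u) (b - w) / heat_kernel T b\<close> as
  the density of the increment \<open>w\<close>, and \<open>heat_kernel_mult\<close> identifies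
  it.\<close>

lemma brownian_bridge_increment_moment_interior:
  fixes X :: "real \<Rightarrow> 'v \<Rightarrow> 'a::euclidean_space"
  assumes bridge: "brownian_bridge M X 0 b T" and s: "0 < s" "s < r" "r < T"
  shows "(\<integral>\<^sup>+\<omega>. ennreal (norm (X r \<omega> - X s \<omega> - ((r - s) / T) *\<^sub>R b) ^ (2 * q)) \<partial>M)
    \<le> ennreal (gaussian_moment_const TYPE('a) q * (r - s) ^ q)"
proof -
  define u where "u = r - s"
  define m where "m = (u / T) *\<^sub>R b"
  define \<sigma> where "\<sigma> = u * (T - u) / T"
  have u: "0 < u" "u < T"
    using s by (auto simp: u_def)
  then have \<sigma>: "0 < \<sigma>" "\<sigma> \<le> u"
    by (auto simp: \<sigma>_def field_simps)
  define F where "F x y = ennreal (heat_kernel s x * heat_kernel u (y - x) * heat_kernel (T - r) (b - y)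
      / heat_kernel T b) * ennreal (norm (y - x - m) ^ (2 * q))" for x y
  interpret psf: product_sigma_finite "\<lambda>_::nat. lborel :: 'a measure"
    by standard
  \<comment> \<open>The grid 0 < s < r < T, indexed as the bridge density with two intermediate
    times requires.\<close>
  define \<tau> where "\<tau> i = (if i = 0 then 0 else if i = 1 then s else if i = 2 then r else T)" for i :: nat
  have Fm [measurable]: "case_prod F \<in> borel_measurable (borel \<Otimes>\<^sub>M borel)"
    unfolding F_def by measurable
  have D: "distributed M (\<Pi>\<^sub>M i\<in>{1..2}. lborel) (\<lambda>\<omega>. \<lambda>i\<in>{1..2}. X (\<tau> i) \<omega>)
          (\<lambda>x. let x' = x(0 := 0, Suc 2 := b) in
             ennreal ((\<Prod>i\<le>2. heat_kernel (\<tau> (Suc i) - \<tau> i) (x' (Suc i) - x' i))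
                        / heat_kernel T (b - 0)))"
  proof -
    have "\<tau> 0 = 0 \<and> \<tau> (Suc 2) = T \<and> (\<forall>i\<le>2. \<tau> i < \<tau> (Suc i))"
    proof (intro conjI allI impI)
      fix i :: nat assume "i \<le> 2"
      then have "i = 0 \<or> i = 1 \<or> i = 2" by auto
      then show "\<tau> i < \<tau> (Suc i)" using s by (auto simp: \<tau>_def)
    qed (simp_all add: \<tau>_def)
    then show ?thesis
      using bridge unfolding brownian_bridge_def by blast
  qed
  let ?g = "\<lambda>x. ennreal (norm (x 2 - x 1 - m) ^ (2 * q)) :: ennreal"
  have g: "?g \<in> borel_measurable (\<Pi>\<^sub>M i\<in>{1..2::nat}. lborel :: 'a measure)"
    by measurable
  have "(\<integral>\<^sup>+\<omega>. ennreal (norm (X r \<omega> - X s \<omega> - m) ^ (2 * q)) \<partial>M)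
      = (\<integral>\<^sup>+\<omega>. ?g (\<lambda>i\<in>{1..2}. X (\<tau> i) \<omega>) \<partial>M)"
    by (simp add: \<tau>_def)
  also have "\<dots> = (\<integral>\<^sup>+x. F (x 1) (x 2) \<partial>(\<Pi>\<^sub>M i\<in>{1..2::nat}. lborel))"
    unfolding distributed_nn_integral[OF D g, symmetric]
    by (intro nn_integral_cong)
       (simp add: F_def \<tau>_def u_def numeral_2_eq_2 atMost_Suc mult.commute mult.left_commute)
  also have "{1..2::nat} = {1, 2}" by auto
  also have "(\<integral>\<^sup>+x. F (x 1) (x 2) \<partial>(\<Pi>\<^sub>M i\<in>{1, 2::nat}. lborel))
      = (\<integral>\<^sup>+z. F (fst z) (snd z) \<partial>(lborel \<Otimes>\<^sub>M lborel))"
    by (rule psf.product_nn_integral_pair) auto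
  also have "\<dots> = (\<integral>\<^sup>+x. \<integral>\<^sup>+y. F x y \<partial>lborel \<partial>lborel)"
    using lborel.nn_integral_fst[of "case_prod F" lborel] by (simp add: split_beta')
  \<comment> \<open>The later position is replaced by the increment \<open>w = y - x\<close> as
    variable of integration.\<close>
  also have "\<dots> = (\<integral>\<^sup>+x. \<integral>\<^sup>+w. F x (w + x) \<partial>lborel \<partial>lborel)"
    by (intro nn_integral_cong nn_integral_lborel_translation[symmetric]) simp
  also have "\<dots> = (\<integral>\<^sup>+w. \<integral>\<^sup>+x. F x (w + x) \<partial>lborel \<partial>lborel)"
    by (rule lborel_pair.Fubini') auto
  also have "\<dots> = (\<integral>\<^sup>+w. ennreal (norm (w - m) ^ (2 * q) * heat_kernel \<sigma> (w - m)) \<partial>lborel)"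
  proof (intro nn_integral_cong)
    fix w :: 'a
    have Tb: "heat_kernel T b > 0" using s by (intro heat_kernel_pos) simp
    have "F x (w + x) = ennreal (heat_kernel u w * norm (w - m) ^ (2 * q) / heat_kernel T b) *
        ennreal (heat_kernel s x * heat_kernel (T - r) ((b - w) - x))" for x
      unfolding F_def by (simp add: ennreal_mult[symmetric] field_simps)
    then have "(\<integral>\<^sup>+x. F x (w + x) \<partial>lborel) =
        ennreal (heat_kernel u w * norm (w - m) ^ (2 * q) / heat_kernel T b) *
        ennreal (heat_kernel (s + (T - r)) (b - w))"
      using s by (simp add: nn_integral_cmult heat_kernel_convolution)
    also have "s + (T - r) = T - u" by (simp add: u_def)
    also have "ennreal (heat_kernel u w * norm (w - m) ^ (2 * q) / heat_kernel T b) *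
        ennreal (heat_kernel (T - u) (b - w)) =
        ennreal ((heat_kernel u w * heat_kernel (T - u) (b - w)) / heat_kernel T b * norm (w - m) ^ (2 * q))"
      by (simp add: ennreal_mult[symmetric] field_simps)
    also have "(heat_kernel u w * heat_kernel (T - u) (b - w)) / heat_kernel T b = heat_kernel \<sigma> (w - m)"
      using heat_kernel_mult[of u "T - u" w b] u Tb by (simp add: \<sigma>_def m_def)
    finally show "(\<integral>\<^sup>+x. F x (w + x) \<partial>lborel) = ennreal (norm (w - m) ^ (2 * q) * heat_kernel \<sigma> (w - m))"
      by (simp add: mult.commute)
  qed
  also have "\<dots> = (\<integral>\<^sup>+w. ennreal (norm (w::'a) ^ (2 * q) * heat_kernel \<sigma> w) \<partial>lborel)"
    using nn_integral_lborel_translation[of "\<lambda>w. ennreal (norm (w::'a) ^ (2 * q) * heat_kernel \<sigma> w)" "- m"]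
    by simp
  also have "\<dots> \<le> ennreal (gaussian_moment_const TYPE('a) q * \<sigma> ^ q)"
    by (rule heat_kernel_moment[OF \<sigma>(1)])
  also have "\<dots> \<le> ennreal (gaussian_moment_const TYPE('a) q * u ^ q)"
    using \<sigma> by (intro ennreal_leI mult_left_mono power_mono) (auto simp: gaussian_moment_const_def)
  finally show ?thesis by (simp add: m_def u_def)
qed

text \<open>The boundary times follow by Fatou's lemma from continuity of the paths.\<close>

lemma brownian_bridge_increment_moment:
  fixes X :: "real \<Rightarrow> 'v \<Rightarrow> 'a::euclidean_space"
  assumes bridge: "brownian_bridge M X 0 b T" and s: "0 \<le> s" "s < r" "r \<le> T"
  shows "(\<integral>\<^sup>+\<omega>. ennreal (norm (X r \<omega> - X s \<omega> - ((r - s) / T) *\<^sub>R b) ^ (2 * q)) \<partial>M)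
    \<le> ennreal (gaussian_moment_const TYPE('a) q * (r - s) ^ q)"
proof -
  \<comment> \<open>Both times move inwards by a fraction strictly below 1/2 of the interval, so
    that they leave the end points and stay in order from the first index on.\<close>
  define \<theta> where "\<theta> n = 1 / real (n + 3)" for n
  define s' where "s' n = s + (r - s) * \<theta> n" for n
  define r' where "r' n = r - (r - s) * \<theta> n" for n
  have \<theta>: "0 < \<theta> n" "\<theta> n < 1 / 2" for n by (auto simp: \<theta>_def field_simps)
  have \<theta>0: "\<theta> \<longlonglongrightarrow> 0" unfolding \<theta>_def
    using LIMSEQ_ignore_initial_segment[OF lim_1_over_n, of 3] by simp
  have ord: "0 < s' n" "s' n < r' n" "r' n < T" "s' n < T" "0 < r' n" for n
  proof -
    have p: "(r - s) * \<theta> n > 0" using \<theta> s by simp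
    then show "0 < s' n" "r' n < T" using s by (simp_all add: s'_def r'_def)
    have "(r - s) * \<theta> n < (r - s) * (1 / 2)"
      using \<theta> s by (intro mult_strict_left_mono) auto
    then show "s' n < r' n" by (simp add: s'_def r'_def field_simps)
    with \<open>0 < s' n\<close> \<open>r' n < T\<close> show "s' n < T" "0 < r' n" by auto
  qed
  have lim: "s' \<longlonglongrightarrow> s" "r' \<longlonglongrightarrow> r"
    using tendsto_intros(1) \<theta>0 unfolding s'_def r'_def by (auto intro!: tendsto_eq_intros)
  have meas: "X t \<in> borel_measurable M" if "0 \<le> t" "t \<le> T" for t
    using bridge that by (simp add: brownian_bridge_def)
  let ?f = "\<lambda>r s \<omega>. ennreal (norm (X r \<omega> - X s \<omega> - ((r - s) / T) *\<^sub>R b) ^ (2 * q))"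
  have "(\<integral>\<^sup>+\<omega>. ?f r s \<omega> \<partial>M) = (\<integral>\<^sup>+\<omega>. liminf (\<lambda>n. ?f (r' n) (s' n) \<omega>) \<partial>M)"
  proof (intro nn_integral_cong)
    fix \<omega> assume "\<omega> \<in> space M"
    then have c: "continuous_on {0..T} (\<lambda>t. X t \<omega>)"
      using bridge by (simp add: brownian_bridge_def)
    have "(\<lambda>n. X (s' n) \<omega>) \<longlonglongrightarrow> X s \<omega>" "(\<lambda>n. X (r' n) \<omega>) \<longlonglongrightarrow> X r \<omega>"
      using ord lim s by (auto intro!: continuous_on_tendsto_compose[OF c] eventuallyI less_imp_le
        intro: order.strict_trans less_trans)
    then have "(\<lambda>n. ?f (r' n) (s' n) \<omega>) \<longlonglongrightarrow> ?f r s \<omega>"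
      using lim s by (intro tendsto_intros) auto
    then show "?f r s \<omega> = liminf (\<lambda>n. ?f (r' n) (s' n) \<omega>)"
      by (intro lim_imp_Liminf[symmetric]) simp_all
  qed
  also have "\<dots> \<le> liminf (\<lambda>n. \<integral>\<^sup>+\<omega>. ?f (r' n) (s' n) \<omega> \<partial>M)"
  proof (rule nn_integral_liminf)
    fix n
    have [measurable]: "X (r' n) \<in> borel_measurable M" "X (s' n) \<in> borel_measurable M"
      by (auto intro!: meas less_imp_le ord)
    show "?f (r' n) (s' n) \<in> borel_measurable M" by measurable
  qed
  also have "\<dots> \<le> liminf (\<lambda>n. ennreal (gaussian_moment_const TYPE('a) q * (r' n - s' n) ^ q))"
    by (intro Liminf_mono eventuallyI brownian_bridge_increment_moment_interior[OF bridge] ord)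
  also have "\<dots> = ennreal (gaussian_moment_const TYPE('a) q * (r - s) ^ q)"
    using lim by (intro lim_imp_Liminf tendsto_intros) auto
  finally show ?thesis .
qed

section \<open>A chaining bound\<close>

definition dyadic_increment :: "real \<Rightarrow> (real \<Rightarrow> 'a::real_normed_vector) \<Rightarrow> nat \<Rightarrow> nat \<Rightarrow> 'a" where
  "dyadic_increment \<delta> f n k = f (real (Suc k) * \<delta> / 2 ^ n) - f (real k * \<delta> / 2 ^ n)"

text \<open>The base \<open>3/2\<close> is one that keeps the expectation finite when the \<open>p\<close>-th moments of the
  increments are quadratic in the time step.\<close>

definition chaining_sum :: "real \<Rightarrow> nat \<Rightarrow> (real \<Rightarrow> 'a::real_normed_vector) \<Rightarrow> ennreal" where
  "chaining_sum \<delta> p f = (\<Sum>n. \<Sum>k<2 ^ n. ennreal ((3 / 2) ^ n * norm (dyadic_increment \<delta> f n k) ^ p))"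

text \<open>The sum of the geometric series whose ratio, the \<open>p\<close>-th root of 2/3, is the
  decay per dyadic level that a bounded chaining sum forces on the increments.\<close>

definition chaining_const :: "nat \<Rightarrow> real" where
  "chaining_const p = 1 / (1 - root p (2 / 3))"

lemma chaining_const_pos: "p > 0 \<Longrightarrow> chaining_const p > 0"
  by (simp add: chaining_const_def real_root_lt_1_iff)

text \<open>A single term of the chaining sum is at most \<open>r ^ p\<close>; dividing by the
  weight \<open>(3 / 2) ^ n\<close> and taking \<open>p\<close>-th roots gives geometric decay in
  the level.\<close>

lemma dyadic_increment_le_chaining_sum:
  assumes "chaining_sum \<delta> p f \<le> ennreal (r ^ p)" "0 \<le> r" "p > 0" "k < 2 ^ n"
  shows "norm (dyadic_increment \<delta> f n k) \<le> root p (2 / 3) ^ n * r"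
proof -
  define \<theta> where "\<theta> = root p (2 / 3)"
  have \<theta>: "\<theta> ^ p = 2 / 3" "\<theta> \<ge> 0"
    using \<open>p > 0\<close> by (auto simp: \<theta>_def)
  let ?a = "norm (dyadic_increment \<delta> f n k)"
  have "ennreal ((3 / 2) ^ n * ?a ^ p) \<le>
      (\<Sum>k<2 ^ n. ennreal ((3 / 2) ^ n * norm (dyadic_increment \<delta> f n k) ^ p))"
    using \<open>k < 2 ^ n\<close> by (intro member_le_sum) auto
  also have "\<dots> \<le> chaining_sum \<delta> p f"
    unfolding chaining_sum_def
    using sum_le_suminf[of "\<lambda>n. \<Sum>k<2 ^ n. ennreal ((3 / 2) ^ n * norm (dyadic_increment \<delta> f n k) ^ p)" "{n}"]
    by simp
  also note assms(1)
  finally have "(3 / 2) ^ n * ?a ^ p \<le> r ^ p"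
    using assms(2) by (subst (asm) ennreal_le_iff) simp_all
  moreover have "(\<theta> ^ n * r) ^ p = (2 / 3) ^ n * r ^ p"
  proof -
    have "(\<theta> ^ n) ^ p = (\<theta> ^ p) ^ n" by (metis power_mult mult.commute)
    then show ?thesis by (simp add: power_mult_distrib \<theta>(1))
  qed
  ultimately have "?a ^ p \<le> (\<theta> ^ n * r) ^ p"
  proof -
    assume a: "(3 / 2) ^ n * ?a ^ p \<le> r ^ p" "(\<theta> ^ n * r) ^ p = (2 / 3) ^ n * r ^ p"
    have "?a ^ p = (2 / 3) ^ n * ((3 / 2) ^ n * ?a ^ p)"
      by (simp add: power_divide)
    also have "\<dots> \<le> (\<theta> ^ n * r) ^ p"
      unfolding a(2) by (intro mult_left_mono a(1)) simp
    finally show ?thesis .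
  qed
  then show ?thesis
    using \<theta> \<open>0 \<le> r\<close> \<open>p > 0\<close> unfolding \<theta>_def[symmetric] by (subst (asm) power_mono_iff) auto
qed

text \<open>Induction over the levels: an even \<open>j\<close> is already a point of the coarser
  grid, and an odd \<open>j\<close> lies one step of the new level to the right of such a point.
  Hence each level contributes at most one increment.\<close>

lemma chaining_dyadic:
  assumes inc: "\<And>n k. k < 2 ^ n \<Longrightarrow> norm (dyadic_increment \<delta> f n k) \<le> a n"
    and "\<And>n. a n \<ge> 0" and "j \<le> 2 ^ m"
  shows "norm (f (real j * \<delta> / 2 ^ m) - f 0) \<le> (\<Sum>n\<le>m. a n)"
  using \<open>j \<le> 2 ^ m\<close>
proof (induction m arbitrary: j)
  case 0
  then have "j = 0 \<or> j = 1" by auto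
  then show ?case
    using inc[of 0 0] assms(2)[of 0] by (auto simp: dyadic_increment_def)
next
  case (Suc m)
  show ?case
  proof (cases "even j")
    case True
    then obtain i where i: "j = 2 * i" by auto
    have "norm (f (real i * \<delta> / 2 ^ m) - f 0) \<le> (\<Sum>n\<le>m. a n)"
      using Suc by (simp add: i)
    moreover have "real i * \<delta> / 2 ^ m = real j * \<delta> / 2 ^ Suc m" by (simp add: i)
    ultimately show ?thesis using assms(2)[of "Suc m"] by (simp del: power_Suc)
  next
    case False
    then obtain i where i: "j = Suc (2 * i)" by (metis oddE Suc_eq_plus1)
    have "norm (f (real i * \<delta> / 2 ^ m) - f 0) \<le> (\<Sum>n\<le>m. a n)"
      using Suc by (simp add: i)
    moreover have "norm (dyadic_increment \<delta> f (Suc m) (2 * i)) \<le> a (Suc m)"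
      using Suc.prems i by (intro inc) simp
    moreover have "f (real j * \<delta> / 2 ^ Suc m) - f 0 =
        dyadic_increment \<delta> f (Suc m) (2 * i) + (f (real i * \<delta> / 2 ^ m) - f 0)"
      by (simp add: dyadic_increment_def i)
    ultimately show ?thesis
      using norm_triangle_ineq[of "dyadic_increment \<delta> f (Suc m) (2 * i)" "f (real i * \<delta> / 2 ^ m) - f 0"]
      by (simp only: sum.atMost_Suc)
  qed
qed

lemma chaining_bound:
  assumes "continuous_on {0..\<delta>} f" "\<delta> > 0" "chaining_sum \<delta> p f \<le> ennreal (r ^ p)" "0 \<le> r" "p > 0"
    and u: "u \<in> {0..\<delta>}"
  shows "norm (f u - f 0) \<le> chaining_const p * r"
proof -
  define \<theta> where "\<theta> = root p (2 / 3)"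
  have \<theta>: "0 \<le> \<theta>" "\<theta> < 1" using \<open>p > 0\<close> by (auto simp: \<theta>_def real_root_lt_1_iff)
  have dy: "norm (f (real j * \<delta> / 2 ^ m) - f 0) \<le> chaining_const p * r" if "j \<le> 2 ^ m" for j m
  proof -
    have "norm (f (real j * \<delta> / 2 ^ m) - f 0) \<le> (\<Sum>n\<le>m. \<theta> ^ n * r)"
      using that dyadic_increment_le_chaining_sum[OF assms(3-5)] \<theta> \<open>0 \<le> r\<close>
      by (intro chaining_dyadic) (auto simp: \<theta>_def)
    also have "\<dots> = (\<Sum>n\<le>m. \<theta> ^ n) * r"
      by (simp add: sum_distrib_right)
    also have "\<dots> \<le> (\<Sum>n. \<theta> ^ n) * r"
      using \<theta> \<open>0 \<le> r\<close> by (intro mult_right_mono sum_le_suminf) (auto simp: summable_geometric)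
    also have "(\<Sum>n. \<theta> ^ n) = chaining_const p"
      using \<theta> by (simp add: suminf_geometric chaining_const_def \<theta>_def)
    finally show ?thesis .
  qed
  \<comment> \<open>Rounding \<open>u\<close> down to the grid of level \<open>m\<close> gives
    dyadic points tending to \<open>u\<close>; continuity extends the bound from these points to
    \<open>u\<close>.\<close>
  define j where "j m = nat \<lfloor>u / \<delta> * 2 ^ m\<rfloor>" for m :: nat
  have v: "0 \<le> u / \<delta>" "u / \<delta> \<le> 1" using u \<open>\<delta> > 0\<close> by auto
  have jl: "real (j m) \<le> u / \<delta> * 2 ^ m" "u / \<delta> * 2 ^ m - 1 \<le> real (j m)" for m
  proof -
    have "real (nat \<lfloor>y\<rfloor>) \<le> y \<and> y - 1 \<le> real (nat \<lfloor>y\<rfloor>)" if "y \<ge> 0" for y :: real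
      using that by linarith
    moreover have "0 \<le> u / \<delta> * 2 ^ m" using v(1) by (rule mult_nonneg_nonneg) simp
    ultimately show "real (j m) \<le> u / \<delta> * 2 ^ m" "u / \<delta> * 2 ^ m - 1 \<le> real (j m)"
      unfolding j_def by blast+
  qed
  have j: "j m \<le> 2 ^ m" for m
  proof -
    have "real (j m) \<le> 1 * 2 ^ m"
      using jl(1)[of m] v(2) by (rule order_trans[OF _ mult_right_mono]) simp
    then have "real (j m) \<le> real (2 ^ m)" by simp
    then show ?thesis by (simp only: of_nat_le_iff)
  qed
  define w where "w m = real (j m) * \<delta> / 2 ^ m" for m
  have w: "w m \<le> u" "u - \<delta> * (1 / 2) ^ m \<le> w m" "0 \<le> w m" for m
  proof -
    have "(u / \<delta> * 2 ^ m - 1) * (\<delta> / 2 ^ m) \<le> real (j m) * (\<delta> / 2 ^ m)"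
      using jl[of m] \<open>\<delta> > 0\<close> by (intro mult_right_mono) auto
    then show "u - \<delta> * (1 / 2) ^ m \<le> w m"
      using \<open>\<delta> > 0\<close> by (simp add: w_def left_diff_distrib diff_divide_distrib power_one_over)
    have "real (j m) * (\<delta> / 2 ^ m) \<le> (u / \<delta> * 2 ^ m) * (\<delta> / 2 ^ m)"
      using jl[of m] \<open>\<delta> > 0\<close> by (intro mult_right_mono) auto
    then show "w m \<le> u"
      using \<open>\<delta> > 0\<close> by (simp add: w_def)
    show "0 \<le> w m" using \<open>\<delta> > 0\<close> by (simp add: w_def)
  qed
  have "w \<longlonglongrightarrow> u"
  proof (rule tendsto_sandwich)
    have "(\<lambda>m. u - \<delta> * (1 / 2) ^ m) \<longlonglongrightarrow> u - \<delta> * 0"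
      by (intro tendsto_intros LIMSEQ_power_zero) auto
    then show "(\<lambda>m. u - \<delta> * (1 / 2) ^ m) \<longlonglongrightarrow> u" by simp
  qed (use w in auto)
  then have "(\<lambda>m. f (w m)) \<longlonglongrightarrow> f u"
    using u w by (intro continuous_on_tendsto_compose[OF assms(1)]) (auto intro!: eventuallyI intro: order_trans)
  then have "(\<lambda>m. norm (f (w m) - f 0)) \<longlonglongrightarrow> norm (f u - f 0)"
    by (intro tendsto_intros)
  then show ?thesis
    by (rule LIMSEQ_le_const2) (use dy j in \<open>auto simp: w_def\<close>)
qed

text \<open>Level \<open>n\<close> has \<open>2 ^ n\<close> increments over time
  \<open>\<delta> / 2 ^ n\<close>. As \<open>q >= 2\<close>, its weighted expectation is at most
  \<open>c * \<delta> ^ q\<close> times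
  \<open>2 ^ n * (3 / 2) ^ n * (1 / 4) ^ n = (3 / 4) ^ n\<close>; summing these powers gives the
  factor 4.\<close>

lemma chaining_sum_expectation:
  fixes Y :: "real \<Rightarrow> 'v \<Rightarrow> 'a::euclidean_space"
  assumes meas: "\<And>u. u \<in> {0..\<delta>} \<Longrightarrow> Y u \<in> borel_measurable M"
    and mom: "\<And>s r. 0 \<le> s \<Longrightarrow> s < r \<Longrightarrow> r \<le> \<delta> \<Longrightarrow>
      (\<integral>\<^sup>+\<omega>. ennreal (norm (Y r \<omega> - Y s \<omega>) ^ p) \<partial>M) \<le> ennreal (c * (r - s) ^ q)"
    and "c \<ge> 0" "\<delta> > 0" "q \<ge> 2"
  shows "(\<lambda>\<omega>. chaining_sum \<delta> p (\<lambda>u. Y u \<omega>)) \<in> borel_measurable M"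
    and "(\<integral>\<^sup>+\<omega>. chaining_sum \<delta> p (\<lambda>u. Y u \<omega>) \<partial>M) \<le> ennreal (4 * c * \<delta> ^ q)"
proof -
  have le: "real k * \<delta> / 2 ^ n \<le> \<delta>" if "k \<le> 2 ^ n" for k n :: nat
  proof -
    have "real k \<le> real (2 ^ n)" using that by (simp only: of_nat_le_iff)
    then show ?thesis using \<open>\<delta> > 0\<close> by (simp add: field_simps)
  qed
  let ?D = "\<lambda>n k \<omega>. dyadic_increment \<delta> (\<lambda>u. Y u \<omega>) n k"
  have m: "?D n k \<in> borel_measurable M" if "k < 2 ^ n" for n k
    unfolding dyadic_increment_def using that \<open>\<delta> > 0\<close>
    by (intro borel_measurable_diff meas) (auto intro!: le simp del: of_nat_Suc)
  have m': "(\<lambda>\<omega>. ennreal (c * norm (?D n k \<omega>) ^ p)) \<in> borel_measurable M" if "k < 2 ^ n" for n k c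
    using m[OF that] by measurable
  have m'': "(\<lambda>\<omega>. \<Sum>k<2 ^ n. ennreal ((3 / 2) ^ n * norm (?D n k \<omega>) ^ p)) \<in> borel_measurable M" for n
    by (intro borel_measurable_sum m') simp
  show "(\<lambda>\<omega>. chaining_sum \<delta> p (\<lambda>u. Y u \<omega>)) \<in> borel_measurable M"
    unfolding chaining_sum_def using m'' by measurable
  have term_le: "(\<integral>\<^sup>+\<omega>. ennreal ((3 / 2) ^ n * norm (?D n k \<omega>) ^ p) \<partial>M)
      \<le> ennreal ((3 / 2) ^ n * (c * (\<delta> / 2 ^ n) ^ q))" if "k < 2 ^ n" for n k
  proof -
    have "(\<integral>\<^sup>+\<omega>. ennreal ((3 / 2) ^ n * norm (?D n k \<omega>) ^ p) \<partial>M)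
        = ennreal ((3 / 2) ^ n) * (\<integral>\<^sup>+\<omega>. ennreal (norm (?D n k \<omega>) ^ p) \<partial>M)"
      using m'[OF that, of 1] by (simp add: ennreal_mult nn_integral_cmult)
    also have "(\<integral>\<^sup>+\<omega>. ennreal (norm (?D n k \<omega>) ^ p) \<partial>M) \<le> ennreal (c * (\<delta> / 2 ^ n) ^ q)"
    proof -
      have "real (Suc k) * \<delta> / 2 ^ n - real k * \<delta> / 2 ^ n = \<delta> / 2 ^ n"
        by (simp add: field_simps)
      then show ?thesis
        using mom[of "real k * \<delta> / 2 ^ n" "real (Suc k) * \<delta> / 2 ^ n"] le[of "Suc k" n] that \<open>\<delta> > 0\<close>
        by (simp add: dyadic_increment_def divide_strict_right_mono del: of_nat_Suc)
    qed
    finally show ?thesis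
      using \<open>c \<ge> 0\<close> \<open>\<delta> > 0\<close> by (simp add: ennreal_mult mult_left_mono)
  qed
  have level: "(\<integral>\<^sup>+\<omega>. (\<Sum>k<2 ^ n. ennreal ((3 / 2) ^ n * norm (?D n k \<omega>) ^ p)) \<partial>M)
      \<le> ennreal (c * \<delta> ^ q * (3 / 4) ^ n)" for n
  proof -
    have "(\<integral>\<^sup>+\<omega>. (\<Sum>k<2 ^ n. ennreal ((3 / 2) ^ n * norm (?D n k \<omega>) ^ p)) \<partial>M)
        = (\<Sum>k<2 ^ n. \<integral>\<^sup>+\<omega>. ennreal ((3 / 2) ^ n * norm (?D n k \<omega>) ^ p) \<partial>M)"
      by (intro nn_integral_sum m') simp
    also have "\<dots> \<le> (\<Sum>k<(2::nat) ^ n. ennreal ((3 / 2) ^ n * (c * (\<delta> / 2 ^ n) ^ q)))"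
      by (intro sum_mono term_le) simp
    also have "\<dots> = ennreal (2 ^ n * ((3 / 2) ^ n * (c * (\<delta> / 2 ^ n) ^ q)))"
      using \<open>c \<ge> 0\<close> \<open>\<delta> > 0\<close> by (subst sum_ennreal) simp_all
    also have "2 ^ n * ((3 / 2) ^ n * (c * (\<delta> / 2 ^ n) ^ q)) \<le> c * \<delta> ^ q * (3 / 4) ^ n"
    proof -
      have "(\<delta> / 2 ^ n) ^ q = \<delta> ^ q * (1 / 2 ^ n) ^ q"
        by (simp add: power_divide)
      also have "\<dots> \<le> \<delta> ^ q * (1 / 2 ^ n) ^ 2"
        using \<open>q \<ge> 2\<close> \<open>\<delta> > 0\<close> by (intro mult_left_mono power_decreasing) auto
      also have "(1 / 2 ^ n :: real) ^ 2 = (1 / 4) ^ n"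
      proof -
        have "(1 / 2 ^ n :: real) ^ 2 = ((1 / 2) ^ n) ^ 2" by (simp add: power_one_over)
        also have "\<dots> = ((1 / 2) ^ 2) ^ n" by (metis power_mult mult.commute)
        finally show ?thesis by (simp add: power2_eq_square)
      qed
      finally have "2 ^ n * ((3 / 2) ^ n * (c * (\<delta> / 2 ^ n) ^ q)) \<le>
          2 ^ n * ((3 / 2) ^ n * (c * (\<delta> ^ q * (1 / 4) ^ n)))"
        using \<open>c \<ge> 0\<close> by (intro mult_left_mono) auto
      also have "\<dots> = c * \<delta> ^ q * (2 ^ n * (3 / 2) ^ n * (1 / 4) ^ n)" by simp
      also have "(2::real) ^ n * (3 / 2) ^ n * (1 / 4) ^ n = (3 / 4) ^ n"
        unfolding power_mult_distrib[symmetric] by simp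
      finally show ?thesis .
    qed
    finally show ?thesis by (simp add: ennreal_leI)
  qed
  have "(\<integral>\<^sup>+\<omega>. chaining_sum \<delta> p (\<lambda>u. Y u \<omega>) \<partial>M)
      = (\<Sum>n. \<integral>\<^sup>+\<omega>. (\<Sum>k<2 ^ n. ennreal ((3 / 2) ^ n * norm (?D n k \<omega>) ^ p)) \<partial>M)"
    unfolding chaining_sum_def by (intro nn_integral_suminf m'')
  also have "\<dots> \<le> (\<Sum>n. ennreal (c * \<delta> ^ q * (3 / 4) ^ n))"
    by (intro suminf_le level) auto
  also have "\<dots> = ennreal (\<Sum>n. c * \<delta> ^ q * (3 / 4) ^ n)"
    using \<open>c \<ge> 0\<close> \<open>\<delta> > 0\<close> by (intro suminf_ennreal2) (auto intro!: summable_mult summable_geometric)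
  also have "(\<Sum>n. c * \<delta> ^ q * (3 / 4) ^ n) = 4 * c * \<delta> ^ q"
    by (subst suminf_mult) (auto simp: suminf_geometric summable_geometric)
  finally show "(\<integral>\<^sup>+\<omega>. chaining_sum \<delta> p (\<lambda>u. Y u \<omega>) \<partial>M) \<le> ennreal (4 * c * \<delta> ^ q)" .
qed

section \<open>Lebesgue measure on the hyperplane\<close>

lemma PiM_lborel_translation:
  fixes c :: "'i \<Rightarrow> real"
  assumes "finite b"
  shows "distr (\<Pi>\<^sub>M u\<in>b. lborel) (\<Pi>\<^sub>M u\<in>b. lborel) (\<lambda>f. \<lambda>u\<in>b. c u + f u) = (\<Pi>\<^sub>M u\<in>b. lborel)"
    (is "distr ?N ?N ?T = _")
proof -
  interpret product_sigma_finite "\<lambda>_::'i. lborel :: real measure"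
    by standard
  have T [measurable]: "?T \<in> measurable ?N ?N" by measurable
  show ?thesis
  proof (rule PiM_eqI[OF \<open>finite b\<close>])
    fix A :: "'i \<Rightarrow> real set" assume A: "\<And>i. i \<in> b \<Longrightarrow> A i \<in> sets lborel"
    have tr: "(\<lambda>y. c i + y) -` A i \<in> sets lborel \<and> emeasure lborel ((\<lambda>y. c i + y) -` A i) = emeasure lborel (A i)"
      if "i \<in> b" for i
    proof -
      have m: "A i \<in> sets borel" using A[OF that] by simp
      have "(\<lambda>y. c i + y) -` A i \<inter> space borel \<in> sets borel"
        by (rule measurable_sets[OF _ m]) measurable
      moreover have "emeasure lborel (A i) = emeasure (distr lborel borel (\<lambda>y. c i + y)) (A i)"
        by (simp add: lborel_distr_plus)
      ultimately show ?thesis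
        using m by (subst (asm) emeasure_distr) auto
    qed
    have "?T -` Pi\<^sub>E b A \<inter> space ?N = Pi\<^sub>E b (\<lambda>i. (\<lambda>y. c i + y) -` A i)"
      by (auto simp: space_PiM PiE_iff extensional_def)
    moreover have "Pi\<^sub>E b A \<in> sets ?N"
      using A \<open>finite b\<close> by (intro sets_PiM_I_finite) auto
    ultimately have "emeasure (distr ?N ?N ?T) (Pi\<^sub>E b A) = emeasure ?N (Pi\<^sub>E b (\<lambda>i. (\<lambda>y. c i + y) -` A i))"
      by (simp add: emeasure_distr)
    also have "\<dots> = (\<Prod>i\<in>b. emeasure lborel ((\<lambda>y. c i + y) -` A i))"
      using tr \<open>finite b\<close> by (intro emeasure_PiM) auto
    also have "\<dots> = (\<Prod>i\<in>b. emeasure lborel (A i))"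
      using tr by (intro prod.cong) auto
    finally show "emeasure (distr ?N ?N ?T) (Pi\<^sub>E b A) = (\<Prod>i\<in>b. emeasure lborel (A i))" .
  qed simp
qed

lemma orthonormal_spanning:
  fixes b :: "'a::euclidean_space set"
  assumes "pairwise orthogonal b" "\<forall>u\<in>b. norm u = 1" "span b = UNIV"
  shows "finite b" "card b = DIM('a)"
proof -
  have i: "independent b"
    using assms(1,2) by (intro pairwise_orthogonal_independent) auto
  then show "finite b" by (rule independent_imp_finite)
  show "card b = DIM('a)"
    using dim_span_eq_card_independent[OF i] assms(3) by simp
qed

text \<open>Uniqueness of a translation invariant measure, normalised by the integral of the Gaussian
  \<open>heat_kernel 1\<close>, which takes the same product form in every orthonormal basis.\<close>

lemma lborel_orthonormal_coordinates:
  fixes b :: "'a::euclidean_space set"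
  assumes orth: "pairwise orthogonal b" "\<forall>u\<in>b. norm u = 1" and span: "span b = UNIV"
  shows "distr (\<Pi>\<^sub>M u\<in>b. lborel) borel (\<lambda>f. \<Sum>u\<in>b. f u *\<^sub>R u) = (lborel :: 'a measure)"
proof -
  note fin = orthonormal_spanning[OF assms]
  let ?N = "\<Pi>\<^sub>M u\<in>b. (lborel :: real measure)"
  define \<phi> where "\<phi> f = (\<Sum>u\<in>b. f u *\<^sub>R u)" for f :: "'a \<Rightarrow> real"
  let ?g = "heat_kernel 1 :: 'a \<Rightarrow> real"
  interpret product_sigma_finite "\<lambda>_::'a. lborel :: real measure"
    by standard
  interpret N: sigma_finite_measure ?N
    by (rule sigma_finite[OF fin(1)])
  interpret P: pair_sigma_finite "lborel :: 'a measure" ?N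
    by standard
  have \<phi> [measurable]: "\<phi> \<in> measurable ?N borel"
    unfolding \<phi>_def by measurable
  have expand: "\<phi> (\<lambda>u. x \<bullet> u) = x" for x
    unfolding \<phi>_def using orth span fin(1) by (intro orthonormal_basis_expand) auto
  have g: "(\<integral>\<^sup>+f. ennreal (?g (x - \<phi> f)) \<partial>?N) = 1" for x
  proof -
    have "x - \<phi> f = (\<Sum>u\<in>b. (x \<bullet> u - f u) *\<^sub>R u)" for f
      by (subst expand[of x, symmetric]) (simp add: \<phi>_def scaleR_diff_left sum_subtractf)
    then have "(\<integral>\<^sup>+f. ennreal (?g (x - \<phi> f)) \<partial>?N) =
        (\<integral>\<^sup>+f. (\<Prod>u\<in>b. ennreal (normal_density 0 1 (x \<bullet> u - f u))) \<partial>?N)"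
      using heat_kernel_orthonormal_sum[of 1 b "\<lambda>u. x \<bullet> u - f u" for f] orth fin
      by (simp add: prod_ennreal)
    also have "\<dots> = (\<Prod>u\<in>b. \<integral>\<^sup>+y. ennreal (normal_density 0 1 (x \<bullet> u - y)) \<partial>lborel)"
      using fin by (intro product_nn_integral_prod) auto
    also have "\<dots> = (\<Prod>u\<in>b. 1)"
    proof (intro prod.cong refl)
      fix u
      have "(\<integral>\<^sup>+y. ennreal (normal_density 0 1 (x \<bullet> u - y)) \<partial>lborel)
          = (\<integral>\<^sup>+y. ennreal (normal_density (x \<bullet> u) 1 y) \<partial>lborel)"
        by (simp add: normal_density_def power2_commute)
      also have "\<dots> = 1"
        by (subst nn_integral_eq_integral) auto
      finally show "(\<integral>\<^sup>+y. ennreal (normal_density 0 1 (x \<bullet> u - y)) \<partial>lborel) = 1" .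
    qed
    finally show ?thesis by simp
  qed
  show ?thesis
  proof (rule measure_eqI)
    fix A assume "A \<in> sets (distr ?N borel (\<lambda>f. \<Sum>u\<in>b. f u *\<^sub>R u))"
    then have A [measurable]: "A \<in> sets borel" by simp
    \<comment> \<open>Insert 1 as a Gaussian integral over the coordinates. Shifting
      \<open>x\<close> by \<open>\<phi> f\<close> moves the translation from the Gaussian to
      \<open>A\<close>, and translation invariance of the coordinate measure then removes
      \<open>x\<close> from the indicator.\<close>
    have "emeasure lborel A = (\<integral>\<^sup>+x. indicator A x * (\<integral>\<^sup>+f. ennreal (?g (x - \<phi> f)) \<partial>?N) \<partial>lborel)"
      by (simp add: g)
    also have "\<dots> = (\<integral>\<^sup>+x. \<integral>\<^sup>+f. indicator A x * ennreal (?g (x - \<phi> f)) \<partial>?N \<partial>lborel)"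
      by (intro nn_integral_cong nn_integral_cmult[symmetric]) measurable
    also have "\<dots> = (\<integral>\<^sup>+f. \<integral>\<^sup>+x. indicator A x * ennreal (?g (x - \<phi> f)) \<partial>lborel \<partial>?N)"
      by (rule P.Fubini'[symmetric]) measurable
    also have "\<dots> = (\<integral>\<^sup>+f. \<integral>\<^sup>+x. indicator A (x + \<phi> f) * ennreal (?g x) \<partial>lborel \<partial>?N)"
    proof (rule nn_integral_cong)
      fix f
      show "(\<integral>\<^sup>+x. indicator A x * ennreal (?g (x - \<phi> f)) \<partial>lborel)
          = (\<integral>\<^sup>+x. indicator A (x + \<phi> f) * ennreal (?g x) \<partial>lborel)"
        using nn_integral_lborel_translation[of "\<lambda>x. indicator A x * ennreal (?g (x - \<phi> f))" "\<phi> f"]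
        by simp
    qed
    also have "\<dots> = (\<integral>\<^sup>+x. \<integral>\<^sup>+f. indicator A (x + \<phi> f) * ennreal (?g x) \<partial>?N \<partial>lborel)"
      by (rule P.Fubini') measurable
    also have "\<dots> = (\<integral>\<^sup>+x. emeasure ?N (\<phi> -` A \<inter> space ?N) * ennreal (?g x) \<partial>lborel)"
    proof (intro nn_integral_cong)
      fix x
      have "x + \<phi> f = \<phi> (\<lambda>u\<in>b. x \<bullet> u + f u)" for f
        by (subst expand[of x, symmetric]) (simp add: \<phi>_def scaleR_add_left sum.distrib)
      then have "(\<integral>\<^sup>+f. indicator A (x + \<phi> f) \<partial>?N) = (\<integral>\<^sup>+f. indicator A (\<phi> (\<lambda>u\<in>b. x \<bullet> u + f u)) \<partial>?N)"
        by simp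
      also have "\<dots> = (\<integral>\<^sup>+f. indicator A (\<phi> f) \<partial>distr ?N ?N (\<lambda>f. \<lambda>u\<in>b. x \<bullet> u + f u))"
        by (subst nn_integral_distr) auto
      also have "\<dots> = (\<integral>\<^sup>+f. indicator (\<phi> -` A \<inter> space ?N) f \<partial>?N)"
        unfolding PiM_lborel_translation[OF fin(1)]
        by (intro nn_integral_cong) (auto simp: indicator_def)
      also have "\<dots> = emeasure ?N (\<phi> -` A \<inter> space ?N)" by simp
      finally show "(\<integral>\<^sup>+f. indicator A (x + \<phi> f) * ennreal (?g x) \<partial>?N) =
          emeasure ?N (\<phi> -` A \<inter> space ?N) * ennreal (?g x)"
        by (subst nn_integral_multc) auto
    qed
    also have "\<dots> = emeasure ?N (\<phi> -` A \<inter> space ?N)"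
      by (subst nn_integral_cmult) (auto simp: heat_kernel_nn_integral)
    also have "\<dots> = emeasure (distr ?N borel \<phi>) A"
      by (rule emeasure_distr[symmetric]) measurable
    finally show "emeasure (distr ?N borel (\<lambda>f. \<Sum>u\<in>b. f u *\<^sub>R u)) A = emeasure lborel A"
      unfolding \<phi>_def by simp
  qed simp
qed

section \<open>Volumes of cylinders over subsets of the hyperplane\<close>

definition cylinder :: "'a::euclidean_space \<Rightarrow> 'a set \<Rightarrow> real \<Rightarrow> real \<Rightarrow> 'a set" where
  "cylinder e C l u = {z. perp_proj e z \<in> C \<and> z \<bullet> e \<in> {l..u}}"

lemma sets_perp_lborel [simp, measurable_cong]: "sets (perp_lborel e) = sets borel"
  by (simp add: perp_lborel_def Let_def)

lemma space_perp_lborel [simp]: "space (perp_lborel e) = UNIV"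
  by (simp add: perp_lborel_def Let_def)

lemma perp_proj_measurable [measurable]: "perp_proj e \<in> borel_measurable borel"
  unfolding perp_proj_def by measurable

lemma perp_proj_in_hyperplane: "norm e = 1 \<Longrightarrow> perp_proj e z \<in> perp_hyperplane e"
  by (simp add: perp_proj_def perp_hyperplane_def inner_diff_left dot_square_norm)

lemma sets_cylinder [measurable]:
  assumes "C \<in> sets borel"
  shows "cylinder e C l u \<in> sets borel"
proof -
  have "cylinder e C l u = perp_proj e -` C \<inter> (\<lambda>z. z \<bullet> e) -` {l..u}"
    by (auto simp: cylinder_def)
  also have "\<dots> \<in> sets borel"
    using assms by (intro sets.Int measurable_sets_borel[where M=borel]) auto
  finally show ?thesis .
qed

text \<open>Adding \<open>e\<close> to the basis chosen in \<open>perp_lborel\<close> gives an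
  orthonormal basis of the whole space. In its coordinates Lebesgue measure is a product, and
  Tonelli's theorem splits off the coordinate along \<open>e\<close>.\<close>

lemma emeasure_cylinder:
  assumes unit: "norm e = 1" and C [measurable]: "C \<in> sets borel" and "l \<le> u"
  shows "emeasure lborel (cylinder e C l u) = emeasure (perp_lborel e) C * ennreal (u - l)"
proof -
  define b where "b = (SOME b. is_perp_basis e b)"
  have b: "is_perp_basis e b" unfolding b_def by (rule someI_ex[OF ex_perp_basis])
  then have be: "v \<bullet> e = 0" if "v \<in> b" for v
    using that by (auto simp: is_perp_basis_def perp_hyperplane_def)
  have ee: "e \<bullet> e = 1" using unit by (simp add: dot_square_norm)
  then have eb: "e \<notin> b" using be by force
  have orth: "pairwise orthogonal (insert e b)" "\<forall>v\<in>insert e b. norm v = 1"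
    using b be unit by (auto simp: is_perp_basis_def pairwise_insert orthogonal_def inner_commute)
  have span: "span (insert e b) = UNIV"
  proof -
    have "z \<in> span (insert e b)" for z
    proof -
      have "perp_proj e z \<in> span b"
        using b perp_proj_in_hyperplane[OF unit] by (simp add: is_perp_basis_def)
      then have "perp_proj e z \<in> span (insert e b)"
        using span_mono[of b "insert e b"] by blast
      then have "perp_proj e z + (z \<bullet> e) *\<^sub>R e \<in> span (insert e b)"
        by (intro span_add span_scale) (simp_all add: span_base)
      then show ?thesis by (simp add: perp_proj_def)
    qed
    then show ?thesis by auto
  qed
  have fin: "finite b" using orthonormal_spanning(1)[OF orth span] by simp
  interpret product_sigma_finite "\<lambda>_::'a. lborel :: real measure"
    by standard
  define \<psi> where "\<psi> f = (\<Sum>v\<in>b. f v *\<^sub>R v)" for f :: "'a \<Rightarrow> real"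
  let ?N = "\<Pi>\<^sub>M v\<in>b. (lborel :: real measure)"
  let ?N' = "\<Pi>\<^sub>M v\<in>insert e b. (lborel :: real measure)"
  have [measurable]: "\<psi> \<in> measurable ?N borel" "(\<lambda>f. \<Sum>v\<in>insert e b. f v *\<^sub>R v) \<in> measurable ?N' borel"
    unfolding \<psi>_def by measurable
  have \<psi>e: "\<psi> f \<bullet> e = 0" for f
    unfolding \<psi>_def inner_sum_left by (intro sum.neutral) (simp add: be)
  have "emeasure lborel (cylinder e C l u) = (\<integral>\<^sup>+z. indicator (cylinder e C l u) z \<partial>lborel)"
    by simp
  also have "\<dots> = (\<integral>\<^sup>+f. indicator (cylinder e C l u) (\<Sum>v\<in>insert e b. f v *\<^sub>R v) \<partial>?N')"
    unfolding lborel_orthonormal_coordinates[OF orth span, symmetric]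
    by (subst nn_integral_distr) auto
  also have "\<dots> = (\<integral>\<^sup>+f. \<integral>\<^sup>+y. indicator (cylinder e C l u) (\<Sum>v\<in>insert e b. (f(e := y)) v *\<^sub>R v) \<partial>lborel \<partial>?N)"
    by (rule product_nn_integral_insert[OF fin eb]) measurable
  also have "\<dots> = (\<integral>\<^sup>+f. \<integral>\<^sup>+y. indicator C (\<psi> f) * indicator {l..u} y \<partial>lborel \<partial>?N)"
  proof (intro nn_integral_cong)
    fix f :: "'a \<Rightarrow> real" and y :: real
    have "(\<Sum>v\<in>insert e b. (f(e := y)) v *\<^sub>R v) = y *\<^sub>R e + \<psi> f"
      using fin eb unfolding \<psi>_def by (simp, intro sum.cong) auto
    then show "indicator (cylinder e C l u) (\<Sum>v\<in>insert e b. (f(e := y)) v *\<^sub>R v) =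
        (indicator C (\<psi> f) * indicator {l..u} y :: ennreal)"
      by (simp add: cylinder_def indicator_def perp_proj_def inner_add_left \<psi>e ee)
  qed
  also have "\<dots> = (\<integral>\<^sup>+f. indicator C (\<psi> f) * ennreal (u - l) \<partial>?N)"
    using \<open>l \<le> u\<close> by (simp add: nn_integral_cmult)
  also have "\<dots> = (\<integral>\<^sup>+f. indicator C (\<psi> f) \<partial>?N) * ennreal (u - l)"
    by (intro nn_integral_multc) measurable
  also have "(\<integral>\<^sup>+f. indicator C (\<psi> f) \<partial>?N) = (\<integral>\<^sup>+z. indicator C z \<partial>distr ?N borel \<psi>)"
    by (subst nn_integral_distr) auto
  also have "distr ?N borel \<psi> = perp_lborel e"
    unfolding perp_lborel_def Let_def b_def[symmetric] \<psi>_def ..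
  finally show ?thesis by simp
qed

text \<open>Finiteness is read off from the cylinder of height 1 over \<open>C\<close>, a bounded
  set in the whole space.\<close>

lemma emeasure_perp_lborel_bounded:
  assumes "norm e = 1" and [measurable]: "C \<in> sets borel" and "bounded C"
  shows "emeasure (perp_lborel e) C < \<infinity>"
proof -
  obtain r where r: "\<And>x. x \<in> C \<Longrightarrow> norm x \<le> r" using \<open>bounded C\<close> by (auto simp: bounded_iff)
  have "norm z \<le> r + 1" if "z \<in> cylinder e C 0 1" for z
  proof -
    have "z = perp_proj e z + (z \<bullet> e) *\<^sub>R e" by (simp add: perp_proj_def)
    then have "norm z \<le> norm (perp_proj e z) + norm ((z \<bullet> e) *\<^sub>R e)" by (metis norm_triangle_ineq)
    also have "\<dots> \<le> r + 1"
      using that r assms(1) by (intro add_mono) (auto simp: cylinder_def)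
    finally show ?thesis .
  qed
  then have "bounded (cylinder e C 0 1)" by (auto simp: bounded_iff)
  then have "emeasure lborel (cylinder e C 0 1) < \<infinity>" by (rule emeasure_bounded_finite)
  then show ?thesis using emeasure_cylinder[of e C 0 1] assms by simp
qed

lemma emeasure_lborel_translation:
  fixes a :: "'a::euclidean_space"
  assumes S: "S \<in> sets borel"
  shows "emeasure lborel {z. z - a \<in> S} = emeasure lborel S" and "{z. z - a \<in> S} \<in> sets borel"
proof -
  have "emeasure lborel S = emeasure (distr lborel borel (\<lambda>x. - a + x)) S"
    by (simp only: lborel_distr_plus)
  also have "\<dots> = emeasure lborel {z. z - a \<in> S}"
    using S by (subst emeasure_distr) (auto simp: vimage_def)
  finally show "emeasure lborel {z. z - a \<in> S} = emeasure lborel S" ..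
  show "{z. z - a \<in> S} \<in> sets borel"
    using S measurable_sets[of "\<lambda>z. z - a" borel borel S] by (simp add: vimage_def)
qed

lemma perp_proj_add: "perp_proj e (x + y) = perp_proj e x + perp_proj e y"
  by (simp add: perp_proj_def inner_add_left scaleR_add_left)

lemma perp_proj_unit [simp]: "norm e = 1 \<Longrightarrow> perp_proj e (c *\<^sub>R e) = 0"
  by (simp add: perp_proj_def dot_square_norm)

lemma norm_perp_proj_le:
  assumes "norm e = 1"
  shows "norm (perp_proj e x) \<le> norm x"
proof -
  have "e \<bullet> e = 1" using assms by (simp add: dot_square_norm)
  then have "(norm (perp_proj e x))\<^sup>2 = (norm x)\<^sup>2 - (x \<bullet> e)\<^sup>2"
    unfolding perp_proj_def power2_norm_eq_inner
    by (simp add: inner_diff_left inner_diff_right inner_commute power2_eq_square)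
  then have "(norm (perp_proj e x))\<^sup>2 \<le> (norm x)\<^sup>2" by simp
  then show ?thesis by (simp add: power2_le_iff_abs_le)
qed

lemma abs_inner_unit_le: "norm e = 1 \<Longrightarrow> \<bar>x \<bullet> e\<bar> \<le> norm x"
  using Cauchy_Schwarz_ineq2[of x e] by simp

lemma continuous_on_perp_proj [continuous_intros]:
  "continuous_on S f \<Longrightarrow> continuous_on S (\<lambda>x. perp_proj e (f x))"
  unfolding perp_proj_def by (intro continuous_intros)

lemma closed_perp_hyperplane: "closed (perp_hyperplane e)"
  using closed_hyperplane[of e 0] by (simp add: perp_hyperplane_def inner_commute)

lemma compact_perp_proj: "compact K \<Longrightarrow> compact (perp_proj e ` K)"
  by (intro compact_continuous_image continuous_intros)

section \<open>Sausages of paths\<close>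

text \<open>With a closed time interval the sausage of a continuous path is a continuous image of a
  compact product, hence compact. Measurability of the half-open sausage is derived from this by
  exhaustion.\<close>

definition closed_sausage :: "'a::euclidean_space set \<Rightarrow> (real \<Rightarrow> 'a) \<Rightarrow> real \<Rightarrow> 'a set" where
  "closed_sausage K \<beta> r = {z. \<exists>s\<in>{0..r}. z - \<beta> s \<in> K}"

lemma compact_closed_sausage:
  assumes "compact K" "continuous_on {0..r} \<beta>"
  shows "compact (closed_sausage K \<beta> r)"
proof -
  have "closed_sausage K \<beta> r = (\<lambda>(s, k). k + \<beta> s) ` ({0..r} \<times> K)"
    unfolding closed_sausage_def by (force simp: image_iff)
  moreover have "continuous_on ({0..r} \<times> K) (\<lambda>(s, k). k + \<beta> s)"
    unfolding split_beta
    by (intro continuous_intros continuous_on_compose2[OF assms(2) continuous_on_fst]) auto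
  ultimately show ?thesis
    using assms(1) by (simp add: compact_continuous_image compact_Times)
qed

text \<open>The offset 2 keeps every end time positive, as the description of the closed sausage by
  rational times requires.\<close>

lemma wiener_sausage_eq_UN:
  assumes "t > 0"
  shows "wiener_sausage K \<beta> t = (\<Union>n. closed_sausage K \<beta> (t - t / real (n + 2)))"
proof -
  have "\<exists>n. s \<le> t - t / real (n + 2)" if "s < t" for s
  proof -
    obtain n where n: "t / (t - s) < real n" using reals_Archimedean2 by blast
    then have "t < real n * (t - s)" using that by (simp add: divide_less_eq)
    also have "\<dots> \<le> real (n + 2) * (t - s)" using that by (intro mult_right_mono) auto
    finally have "t / real (n + 2) \<le> t - s" by (simp add: field_simps)
    then show ?thesis by (intro exI[of _ n]) simp
  qed
  moreover have "s < t" if "s \<le> t - t / real (n + 2)" for s n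
  proof -
    have "0 < t / real (n + 2)" using assms by simp
    with that show ?thesis by linarith
  qed
  ultimately have "{0..<t} = (\<Union>n. {0..t - t / real (n + 2)})"
    by fastforce
  then show ?thesis
    unfolding wiener_sausage_def closed_sausage_def by blast
qed

lemma wiener_sausage_borel:
  assumes "compact K" "continuous_on {0..t} \<beta>" "t > 0"
  shows "wiener_sausage K \<beta> t \<in> sets borel"
  unfolding wiener_sausage_eq_UN[OF \<open>t > 0\<close>]
proof (intro sets.countable_UN image_subsetI borel_closed compact_imp_closed compact_closed_sausage assms(1))
  fix n
  show "continuous_on {0..t - t / real (n + 2)} \<beta>"
    using assms(2) by (rule continuous_on_subset) (use \<open>t > 0\<close> in auto)
qed

lemma grid_bounds:
  assumes "i < N" "(u::real) \<in> {0..\<delta>}" "\<delta> > 0"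
  shows "real i * \<delta> + u \<in> {0..real N * \<delta>}"
proof -
  have "real i * \<delta> + u \<le> (real i + 1) * \<delta>" using assms by (simp add: algebra_simps)
  also have "\<dots> \<le> real N * \<delta>" using assms by (intro mult_right_mono) auto
  finally show ?thesis using assms by simp
qed

lemma continuous_on_grid_piece:
  assumes "continuous_on {0..real N * \<delta>} \<beta>" "\<delta> > 0" "i < N"
  shows "continuous_on {0..\<delta>} (\<lambda>u. \<beta> (real i * \<delta> + u))"
proof (rule continuous_on_compose2[OF assms(1)])
  show "(\<lambda>u. real i * \<delta> + u) ` {0..\<delta>} \<subseteq> {0..real N * \<delta>}"
    by (intro image_subsetI grid_bounds assms)
qed (intro continuous_intros)

lemma wiener_sausage_split:
  assumes "\<delta> > 0"
  shows "wiener_sausage K \<beta> (real N * \<delta>) = (\<Union>i<N. wiener_sausage K (\<lambda>u. \<beta> (real i * \<delta> + u)) \<delta>)"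
proof (intro equalityI subsetI)
  fix z assume "z \<in> wiener_sausage K \<beta> (real N * \<delta>)"
  then obtain s where s: "0 \<le> s" "s < real N * \<delta>" "z - \<beta> s \<in> K" by (auto simp: wiener_sausage_def)
  define i where "i = nat \<lfloor>s / \<delta>\<rfloor>"
  have "0 \<le> s / \<delta>" using s assms by simp
  then have i: "real i \<le> s / \<delta>" "s / \<delta> < real i + 1"
    unfolding i_def by linarith+
  have "s / \<delta> < real N" using s assms by (simp add: divide_less_eq)
  with i have "i < N" by linarith
  moreover have "s - real i * \<delta> \<in> {0..<\<delta>}"
    using i assms by (simp add: field_simps)
  ultimately show "z \<in> (\<Union>i<N. wiener_sausage K (\<lambda>u. \<beta> (real i * \<delta> + u)) \<delta>)"
    using s(3) unfolding wiener_sausage_def by (intro UN_I[of i]) (auto intro!: bexI[of _ "s - real i * \<delta>"])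
next
  fix z assume "z \<in> (\<Union>i<N. wiener_sausage K (\<lambda>u. \<beta> (real i * \<delta> + u)) \<delta>)"
  then obtain i u where i: "i < N" "0 \<le> u" "u < \<delta>" "z - \<beta> (real i * \<delta> + u) \<in> K"
    by (auto simp: wiener_sausage_def)
  have "real i * \<delta> + u < (real i + 1) * \<delta>" using i by (simp add: algebra_simps)
  also have "\<dots> \<le> real N * \<delta>" using i(1) assms by (intro mult_right_mono) auto
  finally show "z \<in> wiener_sausage K \<beta> (real N * \<delta>)"
    using i assms unfolding wiener_sausage_def by (auto intro!: bexI[of _ "real i * \<delta> + u"])
qed

section \<open>One piece of the sausage from above\<close>

text \<open>Full balls of the whole space make this an open set. \<open>perp_lborel e\<close> is
  concentrated on the hyperplane, so only the trace there is measured.\<close>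

definition outer_part :: "'a::euclidean_space \<Rightarrow> 'a set \<Rightarrow> real \<Rightarrow> 'a set" where
  "outer_part e K \<epsilon> = (\<Union>y\<in>perp_proj e ` K. ball y \<epsilon>)"

lemma sets_outer_part [measurable]: "outer_part e K \<epsilon> \<in> sets borel"
  unfolding outer_part_def by (intro borel_open open_UN) auto

text \<open>Up to the fluctuation, \<open>z - f 0\<close> is a point of \<open>K\<close> moved along
  \<open>e\<close>. The fluctuation shifts the projection by less than \<open>\<epsilon>\<close> and
  the height by at most 1, and \<open>K\<close> itself has heights between \<open>- R\<close> and
  \<open>R\<close>: this is the margin \<open>R + 1\<close> at each end.\<close>

lemma wiener_sausage_subset_cylinder:
  assumes unit: "norm e = 1" and K: "K \<subseteq> cball 0 R" and "\<epsilon> \<le> 1" "v \<ge> 0"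
    and fl: "\<And>u. u \<in> {0..\<delta>} \<Longrightarrow> norm (f u - f 0 - (u * v) *\<^sub>R e) < \<epsilon>"
  shows "wiener_sausage K f \<delta> \<subseteq> {z. z - f 0 \<in> cylinder e (outer_part e K \<epsilon>) (- (R + 1)) (v * \<delta> + R + 1)}"
proof safe
  fix z assume "z \<in> wiener_sausage K f \<delta>"
  then obtain u where u: "0 \<le> u" "u < \<delta>" "z - f u \<in> K" by (auto simp: wiener_sausage_def)
  define w where "w = f u - f 0 - (u * v) *\<^sub>R e"
  have w: "norm w < \<epsilon>" using u fl by (simp add: w_def)
  have z: "z - f 0 = (z - f u) + w + (u * v) *\<^sub>R e" by (simp add: w_def)
  have "perp_proj e (z - f 0) = perp_proj e (z - f u) + perp_proj e w"
    unfolding z by (simp only: perp_proj_add perp_proj_unit[OF unit] add_0_right)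
  then have "dist (perp_proj e (z - f u)) (perp_proj e (z - f 0)) < \<epsilon>"
    using norm_perp_proj_le[OF unit, of w] w by (simp add: dist_norm)
  then have "perp_proj e (z - f 0) \<in> outer_part e K \<epsilon>"
    using u unfolding outer_part_def by auto
  moreover have "(z - f 0) \<bullet> e = (z - f u) \<bullet> e + w \<bullet> e + u * v"
    unfolding z using unit by (simp add: inner_add_left dot_square_norm)
  moreover have "\<bar>(z - f u) \<bullet> e\<bar> \<le> R" "\<bar>w \<bullet> e\<bar> \<le> 1"
    using abs_inner_unit_le[OF unit, of "z - f u"] abs_inner_unit_le[OF unit, of w] K u w \<open>\<epsilon> \<le> 1\<close> by auto
  moreover have "0 \<le> u * v" "u * v \<le> v * \<delta>"
    using u \<open>v \<ge> 0\<close> mult_right_mono[of u \<delta> v] by (auto simp: mult.commute)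
  ultimately show "z - f 0 \<in> cylinder e (outer_part e K \<epsilon>) (- (R + 1)) (v * \<delta> + R + 1)"
    unfolding cylinder_def by auto
qed

text \<open>For wild pieces: the fluctuation may be large, and only the radius of the sausage is
  controlled.\<close>

lemma wiener_sausage_subset_cball:
  assumes unit: "norm e = 1" and K: "K \<subseteq> cball 0 R" and "v \<ge> 0"
    and fl: "\<And>u. u \<in> {0..\<delta>} \<Longrightarrow> norm (f u - f 0 - (u * v) *\<^sub>R e) \<le> \<rho>"
  shows "wiener_sausage K f \<delta> \<subseteq> cball (f 0) (R + v * \<delta> + \<rho>)"
proof
  fix z assume "z \<in> wiener_sausage K f \<delta>"
  then obtain u where u: "0 \<le> u" "u < \<delta>" "z - f u \<in> K" by (auto simp: wiener_sausage_def)
  have "z - f 0 = (z - f u) + (u * v) *\<^sub>R e + (f u - f 0 - (u * v) *\<^sub>R e)" by simp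
  then have "norm (z - f 0) \<le> norm (z - f u) + norm ((u * v) *\<^sub>R e) + norm (f u - f 0 - (u * v) *\<^sub>R e)"
    using norm_triangle_mono[OF norm_triangle_ineq order_refl] by (simp only:)
  also have "\<dots> \<le> R + v * \<delta> + \<rho>"
  proof (intro add_mono)
    show "norm ((u * v) *\<^sub>R e) \<le> v * \<delta>"
      using u \<open>v \<ge> 0\<close> unit mult_right_mono[of u \<delta> v] by (simp add: mult.commute)
  qed (use u K fl[of u] in auto)
  finally show "z \<in> cball (f 0) (R + v * \<delta> + \<rho>)"
    by (simp add: dist_norm norm_minus_commute)
qed

lemma linear_drift_fluctuation:
  assumes "continuous_on {0..\<delta>} f" "\<delta> > 0" "p > 0" "0 \<le> r"
    and "chaining_sum \<delta> p (\<lambda>u. f u - (u * v) *\<^sub>R e) \<le> ennreal (r ^ p)" and "u \<in> {0..\<delta>}"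
  shows "norm (f u - f 0 - (u * v) *\<^sub>R e) \<le> chaining_const p * r"
proof -
  have "norm ((f u - (u * v) *\<^sub>R e) - (f 0 - (0 * v) *\<^sub>R e)) \<le> chaining_const p * r"
    using assms by (intro chaining_bound[of \<delta> "\<lambda>u. f u - (u * v) *\<^sub>R e"]) (auto intro!: continuous_intros)
  then show ?thesis by (simp add: algebra_simps)
qed

text \<open>A constant \<open>C\<close> for which a ball of radius
  \<open>s + chaining_const p * r\<close> has volume at most \<open>C * r ^ (2 * d)\<close> for all
  \<open>r >= \<rho>\<close>. One factor \<open>r / \<rho>\<close> absorbs the summand
  \<open>s\<close> into the radius, and \<open>d\<close> more raise the power from \<open>d\<close>
  to \<open>2 * d\<close>.\<close>

definition bad_volume_const :: "'a::euclidean_space itself \<Rightarrow> nat \<Rightarrow> real \<Rightarrow> real \<Rightarrow> real" where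
  "bad_volume_const _ p \<rho> s = unit_ball_vol (real DIM('a)) * (s / \<rho> + chaining_const p) ^ DIM('a) / \<rho> ^ DIM('a)"

lemma bad_volume_const_pos:
  assumes "p > 0" "\<rho> > 0" "s \<ge> 0"
  shows "bad_volume_const TYPE('a::euclidean_space) p \<rho> s > 0"
  using assms chaining_const_pos[OF \<open>p > 0\<close>] unfolding bad_volume_const_def
  by (intro divide_pos_pos mult_pos_pos zero_less_power add_nonneg_pos) auto

text \<open>The alternative is whether the chaining sum exceeds \<open>\<rho> ^ p\<close>. The
  choice of \<open>\<rho>\<close> makes \<open>chaining_const p * \<rho>\<close> equal to
  \<open>\<epsilon> / 2\<close>, so below the threshold the cylinder bound holds. Above it, the
  volume of an enclosing ball is paid for by the chaining sum.\<close>

lemma emeasure_wiener_sausage_piece_le: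
  fixes f :: "real \<Rightarrow> 'a::euclidean_space"
  assumes unit: "norm e = 1" and K: "K \<subseteq> cball 0 R" and R: "R \<ge> 0" and \<epsilon>: "0 < \<epsilon>" "\<epsilon> \<le> 1"
    and v: "v \<ge> 0" "v * \<delta> \<le> \<Lambda>" and f: "continuous_on {0..\<delta>} f" "\<delta> > 0"
    and p: "p = 2 * DIM('a)" and \<rho>: "\<rho> = \<epsilon> / (2 * chaining_const p)"
  shows "emeasure lborel (wiener_sausage K f \<delta>) \<le>
    emeasure (perp_lborel e) (outer_part e K \<epsilon>) * ennreal (v * \<delta> + 2 * (R + 1)) +
    ennreal (bad_volume_const TYPE('a) p \<rho> (R + \<Lambda>)) * chaining_sum \<delta> p (\<lambda>u. f u - (u * v) *\<^sub>R e)"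
    (is "?V \<le> ?G + ennreal ?C * ?Z")
proof -
  let ?A = "chaining_const p"
  have p0: "p > 0" by (simp add: p)
  have A: "?A > 0" by (rule chaining_const_pos[OF p0])
  have \<rho>0: "\<rho> > 0" using \<epsilon> A by (simp add: \<rho>)
  have \<Lambda>: "\<Lambda> \<ge> 0" using v f(2) order_trans[OF mult_nonneg_nonneg[of v \<delta>] v(2)] by simp
  have C: "?C > 0" using p0 \<rho>0 R \<Lambda> by (intro bad_volume_const_pos) auto
  show ?thesis
  proof (cases "?Z \<le> ennreal (\<rho> ^ p)")
    case True
    have fl: "norm (f u - f 0 - (u * v) *\<^sub>R e) < \<epsilon>" if "u \<in> {0..\<delta>}" for u
    proof -
      have "norm (f u - f 0 - (u * v) *\<^sub>R e) \<le> ?A * \<rho>"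
        using True that f p0 \<rho>0 by (intro linear_drift_fluctuation) auto
      also have "\<dots> < \<epsilon>" using A \<epsilon> by (simp add: \<rho>)
      finally show ?thesis .
    qed
    have cyl: "cylinder e (outer_part e K \<epsilon>) (- (R + 1)) (v * \<delta> + R + 1) \<in> sets borel"
      by measurable
    have "?V \<le> emeasure lborel {z. z - f 0 \<in> cylinder e (outer_part e K \<epsilon>) (- (R + 1)) (v * \<delta> + R + 1)}"
      using wiener_sausage_subset_cylinder[OF unit K \<open>\<epsilon> \<le> 1\<close> \<open>v \<ge> 0\<close> fl] emeasure_lborel_translation(2)[OF cyl]
      by (intro emeasure_mono) auto
    also have "\<dots> = ?G"
    proof -
      have "0 \<le> v * \<delta>" using v f(2) by simp
      then have "- (R + 1) \<le> v * \<delta> + R + 1" using R by linarith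
      then have "emeasure lborel (cylinder e (outer_part e K \<epsilon>) (- (R + 1)) (v * \<delta> + R + 1)) =
          emeasure (perp_lborel e) (outer_part e K \<epsilon>) * ennreal (v * \<delta> + R + 1 - - (R + 1))"
        by (intro emeasure_cylinder[OF unit]) measurable
      also have "v * \<delta> + R + 1 - - (R + 1) = v * \<delta> + 2 * (R + 1)" by simp
      finally show ?thesis unfolding emeasure_lborel_translation(1)[OF cyl] .
    qed
    finally show ?thesis by (simp add: add_increasing2)
  next
    case False
    show ?thesis
    proof (cases "?Z = \<infinity>")
      case True
      then have "ennreal ?C * ?Z = \<infinity>" using C by (simp add: ennreal_mult_top)
      then show ?thesis by simp
    next
      case fin: False
      define r where "r = root p (enn2real ?Z)"
      have r: "r \<ge> 0" "r ^ p = enn2real ?Z" using p0 by (auto simp: r_def)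
      then have Z: "?Z = ennreal (r ^ p)" using fin by (simp add: less_top)
      have "\<rho> ^ p < r ^ p"
      proof (rule ccontr)
        assume "\<not> \<rho> ^ p < r ^ p"
        then have "?Z \<le> ennreal (\<rho> ^ p)" unfolding Z by (intro ennreal_leI) simp
        with False show False by contradiction
      qed
      then have r\<rho>: "\<rho> < r" using r(1) by (rule power_less_imp_less_base)
      have fl: "norm (f u - f 0 - (u * v) *\<^sub>R e) \<le> ?A * r" if "u \<in> {0..\<delta>}" for u
        using Z that f p0 r by (intro linear_drift_fluctuation) auto
      have "?V \<le> emeasure lborel (cball (f 0) (R + v * \<delta> + ?A * r))"
        by (intro emeasure_mono wiener_sausage_subset_cball[OF unit K \<open>v \<ge> 0\<close> fl]) auto
      also have "\<dots> = ennreal (unit_ball_vol (real DIM('a)) * (R + v * \<delta> + ?A * r) ^ DIM('a))"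
        using R v f(2) A r by (intro emeasure_cball) simp
      also have "\<dots> \<le> ennreal (?C * r ^ p)"
      proof (rule ennreal_leI)
        have "R + v * \<delta> + ?A * r \<le> (R + \<Lambda>) * 1 + ?A * r" using v by simp
        also have "\<dots> \<le> (R + \<Lambda>) * (r / \<rho>) + ?A * r"
          using R \<Lambda> r\<rho> \<rho>0 by (intro add_right_mono mult_left_mono) auto
        also have "\<dots> = ((R + \<Lambda>) / \<rho> + ?A) * r" by (simp add: algebra_simps)
        finally have "(R + v * \<delta> + ?A * r) ^ DIM('a) \<le> (((R + \<Lambda>) / \<rho> + ?A) * r) ^ DIM('a)"
          using R v f(2) A r by (intro power_mono) auto
        also have "\<dots> = ((R + \<Lambda>) / \<rho> + ?A) ^ DIM('a) * r ^ DIM('a) * 1" by (simp add: power_mult_distrib)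
        \<comment> \<open>The factor \<open>(r / \<rho>) ^ DIM('a)\<close> is at least 1 and raises
          the power of \<open>r\<close> to \<open>p\<close>, the power that \<open>?Z\<close>
          represents.\<close>
        also have "\<dots> \<le> ((R + \<Lambda>) / \<rho> + ?A) ^ DIM('a) * r ^ DIM('a) * (r / \<rho>) ^ DIM('a)"
          using R \<Lambda> less_imp_le[OF A] r r\<rho> \<rho>0 by (intro mult_left_mono one_le_power) auto
        also have "\<dots> = ((R + \<Lambda>) / \<rho> + ?A) ^ DIM('a) / \<rho> ^ DIM('a) * r ^ p"
          by (simp add: p power_divide mult_2 power_add)
        finally show "unit_ball_vol (real DIM('a)) * (R + v * \<delta> + ?A * r) ^ DIM('a) \<le> ?C * r ^ p"
          unfolding bad_volume_const_def times_divide_eq_right[symmetric] mult.assoc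
          by (intro mult_left_mono) simp_all
      qed
      also have "\<dots> = ennreal ?C * ?Z"
        using C r by (simp add: Z ennreal_mult)
      finally show ?thesis by (simp add: add_increasing)
    qed
  qed
qed

lemma emeasure_wiener_sausage_le:
  fixes \<beta> :: "real \<Rightarrow> 'a::euclidean_space"
  assumes unit: "norm e = 1" and K: "compact K" "K \<subseteq> cball 0 R" and R: "R \<ge> 0" and \<epsilon>: "0 < \<epsilon>" "\<epsilon> \<le> 1"
    and v: "v \<ge> 0" "v * \<delta> \<le> \<Lambda>" and \<beta>: "continuous_on {0..real N * \<delta>} \<beta>" "\<delta> > 0"
    and p: "p = 2 * DIM('a)" and \<rho>: "\<rho> = \<epsilon> / (2 * chaining_const p)"
  shows "emeasure lborel (wiener_sausage K \<beta> (real N * \<delta>)) \<le>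
    (\<Sum>i<N. emeasure (perp_lborel e) (outer_part e K \<epsilon>) * ennreal (v * \<delta> + 2 * (R + 1)) +
      ennreal (bad_volume_const TYPE('a) p \<rho> (R + \<Lambda>)) *
      chaining_sum \<delta> p (\<lambda>u. \<beta> (real i * \<delta> + u) - (u * v) *\<^sub>R e))"
proof -
  have c: "continuous_on {0..\<delta>} (\<lambda>u. \<beta> (real i * \<delta> + u))" if "i < N" for i
    by (rule continuous_on_grid_piece[OF \<beta> that])
  have "emeasure lborel (wiener_sausage K \<beta> (real N * \<delta>))
      \<le> (\<Sum>i<N. emeasure lborel (wiener_sausage K (\<lambda>u. \<beta> (real i * \<delta> + u)) \<delta>))"
    unfolding wiener_sausage_split[OF \<open>\<delta> > 0\<close>]
    using wiener_sausage_borel[OF K(1) c \<beta>(2)] by (intro emeasure_subadditive_finite) auto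
  also have "\<dots> \<le> (\<Sum>i<N. emeasure (perp_lborel e) (outer_part e K \<epsilon>) * ennreal (v * \<delta> + 2 * (R + 1)) +
      ennreal (bad_volume_const TYPE('a) p \<rho> (R + \<Lambda>)) *
      chaining_sum \<delta> p (\<lambda>u. \<beta> (real i * \<delta> + u) - (u * v) *\<^sub>R e))"
    using c by (intro sum_mono emeasure_wiener_sausage_piece_le[OF unit K(2) R \<epsilon> v _ \<beta>(2) p \<rho>]) auto
  finally show ?thesis .
qed

section \<open>One piece of the sausage from below\<close>

text \<open>The fibre of \<open>K\<close> above a point of the projection is nonempty and compact,
  so its supremum is a maximum. Thus the graph of the upper height lies in \<open>K\<close>, and the
  extended real is finite.\<close>

lemma upper_height_attained:
  assumes K: "compact K" "K \<subseteq> cball 0 R" and unit: "norm e = 1" and z: "z \<in> perp_proj e ` K"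
  obtains h where "upper_height e K z = ereal h" "z + h *\<^sub>R e \<in> K" "\<bar>h\<bar> \<le> R"
proof -
  define S where "S = {s. z + s *\<^sub>R e \<in> K}"
  have "z \<bullet> e = 0"
    using z perp_proj_in_hyperplane[OF unit] by (auto simp: perp_hyperplane_def)
  then have "(z + s *\<^sub>R e) \<bullet> e = s" for s
    using unit by (simp add: inner_add_left dot_square_norm)
  then have bd: "\<bar>s\<bar> \<le> R" if "s \<in> S" for s
    using abs_inner_unit_le[OF unit, of "z + s *\<^sub>R e"] subsetD[OF K(2), of "z + s *\<^sub>R e"] that
    by (simp add: S_def)
  have "closed S"
    unfolding S_def
    using closed_vimage[OF compact_imp_closed[OF K(1)], of "\<lambda>s. z + s *\<^sub>R e"]
    by (simp add: vimage_def continuous_intros)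
  moreover have "bounded S" using bd by (auto simp: bounded_iff)
  ultimately have "compact S" by (simp add: compact_eq_bounded_closed)
  moreover have "S \<noteq> {}"
  proof -
    obtain k where k: "k \<in> K" "z = perp_proj e k" using z by auto
    then have "z + (k \<bullet> e) *\<^sub>R e = k" by (simp add: perp_proj_def)
    then have "k \<bullet> e \<in> S" using k by (simp add: S_def)
    then show ?thesis by blast
  qed
  ultimately obtain h where h: "h \<in> S" "\<And>s. s \<in> S \<Longrightarrow> s \<le> h"
    using compact_attains_sup[of S] by metis
  have "upper_height e K z = ereal h"
    unfolding upper_height_def S_def[symmetric]
  proof (rule Sup_eqI)
    show "y \<le> ereal h" if "y \<in> ereal ` S" for y using that h(2) by force
    show "ereal h \<le> y" if "\<And>s. s \<in> ereal ` S \<Longrightarrow> s \<le> y" for y using that h(1) by blast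
  qed
  moreover have "z + h *\<^sub>R e \<in> K" using h(1) by (simp add: S_def)
  ultimately show ?thesis using bd[OF h(1)] by (rule that)
qed

text \<open>The closure of \<open>dis_ct e K\<close> is removed, and not just the set itself, to
  make the result relatively open: each of its points then has a neighbourhood in which the
  projection of a fluctuating path can move.\<close>

definition height_continuity_set :: "'a::euclidean_space \<Rightarrow> 'a set \<Rightarrow> 'a set" where
  "height_continuity_set e K =
     (top_of_set (perp_hyperplane e) interior_of (perp_proj e ` K)) - closure (dis_ct e K)"

lemma height_continuity_set_subset: "height_continuity_set e K \<subseteq> perp_proj e ` K"
  unfolding height_continuity_set_def using interior_of_subset by fastforce

lemma openin_height_continuity_set:
  "openin (top_of_set (perp_hyperplane e)) (height_continuity_set e K)"
  unfolding height_continuity_set_def Diff_eq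
  by (intro openin_Int_open openin_interior_of open_Compl closed_closure)

lemma continuous_on_height:
  assumes K: "compact K" and unit: "norm e = 1"
  shows "continuous_on (height_continuity_set e K) (\<lambda>y. real_of_ereal (upper_height e K y))"
  unfolding continuous_on_def
proof
  obtain R where "\<And>x. x \<in> K \<Longrightarrow> norm x \<le> R"
    using compact_imp_bounded[OF K] unfolding bounded_iff by blast
  then have R: "K \<subseteq> cball 0 R" by auto
  fix y assume y: "y \<in> height_continuity_set e K"
  then have "y \<in> top_of_set (perp_hyperplane e) interior_of (perp_proj e ` K)" "y \<notin> dis_ct e K"
    using closure_subset by (auto simp: height_continuity_set_def)
  then have "continuous (at y within perp_hyperplane e) (upper_height e K)"
    by (auto simp: dis_ct_def)
  then have "continuous (at y within height_continuity_set e K) (upper_height e K)"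
    using openin_imp_subset[OF openin_height_continuity_set] by (rule continuous_within_subset)
  moreover obtain h where h: "upper_height e K y = ereal h"
    by (rule upper_height_attained[OF K R unit subsetD[OF height_continuity_set_subset y]])
  ultimately have "(upper_height e K \<longlongrightarrow> ereal h) (at y within height_continuity_set e K)"
    by (simp add: continuous_within)
  then show "((\<lambda>y. real_of_ereal (upper_height e K y)) \<longlongrightarrow> real_of_ereal (upper_height e K y))
      (at y within height_continuity_set e K)"
    unfolding h real_of_ereal.simps by (rule lim_real_of_ereal)
qed

lemma sets_height_continuity_set [measurable]: "height_continuity_set e K \<in> sets borel"
proof -
  obtain T where "open T" "height_continuity_set e K = perp_hyperplane e \<inter> T"
    using openin_height_continuity_set by (metis openin_open)
  then show ?thesis using closed_perp_hyperplane by (auto intro: borel_closed borel_open)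
qed

text \<open>A point of the projection outside its relative interior lies in the frontier, which is
  part of \<open>dis_ct e K\<close>. The projection is therefore covered by the continuity set and a
  null set.\<close>

lemma emeasure_height_continuity_set:
  assumes K: "compact K" and unit: "norm e = 1"
    and null: "emeasure (perp_lborel e) (closure (dis_ct e K)) = 0"
  shows "emeasure (perp_lborel e) (height_continuity_set e K) = emeasure (perp_lborel e) (perp_proj e ` K)"
proof (rule antisym)
  let ?M = "perp_lborel e"
  have pK: "perp_proj e ` K \<in> sets borel"
    by (intro borel_closed compact_imp_closed compact_perp_proj K)
  then show "emeasure ?M (height_continuity_set e K) \<le> emeasure ?M (perp_proj e ` K)"
    by (intro emeasure_mono height_continuity_set_subset) simp
  have "perp_proj e ` K \<subseteq> perp_hyperplane e"
    using perp_proj_in_hyperplane[OF unit] by auto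
  then have "perp_proj e ` K \<subseteq> top_of_set (perp_hyperplane e) closure_of (perp_proj e ` K)"
    by (intro closure_of_subset) simp
  then have "perp_proj e ` K \<subseteq> height_continuity_set e K \<union> closure (dis_ct e K)"
    using closure_subset[of "dis_ct e K"]
    unfolding height_continuity_set_def dis_ct_def frontier_of_def by blast
  then have "emeasure ?M (perp_proj e ` K) \<le> emeasure ?M (height_continuity_set e K \<union> closure (dis_ct e K))"
    by (intro emeasure_mono) auto
  also have "\<dots> \<le> emeasure ?M (height_continuity_set e K) + emeasure ?M (closure (dis_ct e K))"
    by (intro emeasure_subadditive) auto
  finally show "emeasure ?M (perp_proj e ` K) \<le> emeasure ?M (height_continuity_set e K)"
    by (simp add: null)
qed

text \<open>If \<open>perp_proj e (z - f 0)\<close> is such a point and \<open>f\<close> stays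
  within \<open>\<epsilon>\<close> of its drift, then \<open>perp_proj e (z - f u)\<close> remains
  in the continuity set. The neighbourhoods are relative to the hyperplane, since a ball of the
  whole space would leave it.\<close>

definition inner_part :: "'a::euclidean_space \<Rightarrow> 'a set \<Rightarrow> real \<Rightarrow> 'a set" where
  "inner_part e K \<epsilon> =
     {y \<in> perp_hyperplane e. \<forall>y'\<in>perp_hyperplane e. dist y y' < \<epsilon> \<longrightarrow> y' \<in> height_continuity_set e K}"

lemma sets_inner_part [measurable]: "inner_part e K \<epsilon> \<in> sets borel"
proof -
  have "inner_part e K \<epsilon> = perp_hyperplane e - (\<Union>y'\<in>perp_hyperplane e - height_continuity_set e K. ball y' \<epsilon>)"
    by (auto simp: inner_part_def dist_commute)
  then show ?thesis
    by (simp add: closed_perp_hyperplane borel_closed borel_open sets.Diff open_UN)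
qed

text \<open>Along the path, \<open>(z - f u) \<bullet> e\<close> minus the height of \<open>K\<close> above the projection of \<open>z - f u\<close>
  changes sign, so \<open>z - f u\<close> crosses the upper surface of \<open>K\<close>.\<close>

lemma cylinder_subset_wiener_sausage:
  assumes K: "compact K" "K \<subseteq> cball 0 R" and unit: "norm e = 1" and "\<epsilon> \<le> 1" "\<delta> > 0"
    and f: "continuous_on {0..\<delta>} f"
    and fl: "\<And>u. u \<in> {0..\<delta>} \<Longrightarrow> norm (f u - f 0 - (u * v) *\<^sub>R e) < \<epsilon>"
  shows "{z. z - f 0 \<in> cylinder e (inner_part e K \<epsilon>) (R + 1) (v * \<delta> - (R + 1))} \<subseteq> wiener_sausage K f \<delta>"
proof safe
  fix z assume z: "z - f 0 \<in> cylinder e (inner_part e K \<epsilon>) (R + 1) (v * \<delta> - (R + 1))"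
  let ?U = "height_continuity_set e K"
  define H where "H y = real_of_ereal (upper_height e K y)" for y
  define y where "y u = perp_proj e (z - f u)" for u
  have H: "y + H y *\<^sub>R e \<in> K" "\<bar>H y\<bar> \<le> R" if inU: "y \<in> ?U" for y
  proof -
    obtain h where "upper_height e K y = ereal h" "y + h *\<^sub>R e \<in> K" "\<bar>h\<bar> \<le> R"
      by (rule upper_height_attained[OF K unit subsetD[OF height_continuity_set_subset inU]])
    then show "y + H y *\<^sub>R e \<in> K" "\<bar>H y\<bar> \<le> R" by (simp_all add: H_def)
  qed
  have yU: "y u \<in> ?U" if u: "u \<in> {0..\<delta>}" for u
  proof -
    define w where "w = f u - f 0 - (u * v) *\<^sub>R e"
    have "z - f 0 = (z - f u) + w + (u * v) *\<^sub>R e" by (simp add: w_def)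
    then have "perp_proj e (z - f 0) = y u + perp_proj e w"
      by (simp only: perp_proj_add perp_proj_unit[OF unit] add_0_right y_def)
    then have "dist (perp_proj e (z - f 0)) (y u) < \<epsilon>"
      using norm_perp_proj_le[OF unit, of w] fl[OF u] by (simp add: dist_norm w_def)
    then show ?thesis
      using z perp_proj_in_hyperplane[OF unit] by (auto simp: cylinder_def inner_part_def y_def)
  qed
  define \<phi> where "\<phi> u = (z - f u) \<bullet> e - H (y u)" for u
  have "continuous_on {0..\<delta>} (\<lambda>u. H (y u))"
  proof (rule continuous_on_compose2[of ?U H])
    show "continuous_on ?U H" unfolding H_def by (rule continuous_on_height[OF K(1) unit])
    show "continuous_on {0..\<delta>} y" unfolding y_def by (intro continuous_intros f)
  qed (use yU in auto)
  then have c: "continuous_on {0..\<delta>} \<phi>"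
    unfolding \<phi>_def by (intro continuous_intros f)
  \<comment> \<open>The margin \<open>R + 1\<close> fixes the signs at both ends: at time 0 the
    component of \<open>z - f 0\<close> along \<open>e\<close> is above every height of
    \<open>K\<close>, and at time \<open>\<delta>\<close> it is below \<open>- R\<close>, even after
    a fluctuation of size less than 1.\<close>
  have "\<phi> 0 > 0"
    using z H(2)[OF yU[of 0]] \<open>\<delta> > 0\<close> by (auto simp: \<phi>_def cylinder_def)
  have "\<phi> \<delta> < 0"
  proof -
    define w where "w = f \<delta> - f 0 - (\<delta> * v) *\<^sub>R e"
    have zw: "z - f \<delta> = (z - f 0) - w - (\<delta> * v) *\<^sub>R e" by (simp add: w_def)
    have "(z - f \<delta>) \<bullet> e = (z - f 0) \<bullet> e - w \<bullet> e - \<delta> * v"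
      unfolding zw using unit
      by (simp only: inner_diff_left inner_scaleR_left dot_square_norm one_power2 mult_1_right)
    moreover have "(z - f 0) \<bullet> e \<le> v * \<delta> - (R + 1)"
      using z by (simp add: cylinder_def)
    moreover have "\<bar>w \<bullet> e\<bar> < 1"
      using abs_inner_unit_le[OF unit, of w] fl[of \<delta>] \<open>\<delta> > 0\<close> \<open>\<epsilon> \<le> 1\<close> by (simp add: w_def)
    moreover have "\<bar>H (y \<delta>)\<bar> \<le> R" using \<open>\<delta> > 0\<close> by (intro H yU) auto
    ultimately show ?thesis unfolding \<phi>_def by (simp add: mult.commute)
  qed
  obtain u where u: "0 \<le> u" "u \<le> \<delta>" "\<phi> u = 0"
    using IVT2'[of \<phi> \<delta> 0 0] \<open>\<phi> 0 > 0\<close> \<open>\<phi> \<delta> < 0\<close> \<open>\<delta> > 0\<close> c less_imp_le by blast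
  \<comment> \<open>The sausage takes only times before \<open>\<delta>\<close>; the strict sign at
    \<open>\<delta>\<close> excludes that end.\<close>
  with \<open>\<phi> \<delta> < 0\<close> have "u < \<delta>" by (cases "u = \<delta>") auto
  have "z - f u = y u + H (y u) *\<^sub>R e"
    using u(3) by (simp add: \<phi>_def y_def perp_proj_def)
  also have "\<dots> \<in> K" using u by (intro H yU) auto
  finally show "z \<in> wiener_sausage K f \<delta>"
    using u \<open>u < \<delta>\<close> by (auto simp: wiener_sausage_def)
qed

section \<open>Cylinders of different pieces and their overlaps\<close>

text \<open>The overlaps stand on the right because \<open>ennreal\<close> has only truncated
  subtraction. The induction adds one set and bounds its intersection with the earlier union by
  subadditivity.\<close>

lemma bonferroni_emeasure:
  fixes A :: "nat \<Rightarrow> 'b set"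
  assumes A: "\<And>i. A i \<in> sets M"
  shows "(\<Sum>i<N. emeasure M (A i)) \<le> emeasure M (\<Union>i<N. A i) + (\<Sum>i<N. \<Sum>j<i. emeasure M (A i \<inter> A j))"
proof (induction N)
  case (Suc N)
  let ?U = "\<Union>i<N. A i"
  have "emeasure M (A N \<inter> ?U) = emeasure M (\<Union>j<N. A N \<inter> A j)"
    by (intro arg_cong[where f="emeasure M"]) auto
  also have "\<dots> \<le> (\<Sum>j<N. emeasure M (A N \<inter> A j))"
    using A by (intro emeasure_subadditive_finite) auto
  finally have 1: "emeasure M (A N \<inter> ?U) \<le> (\<Sum>j<N. emeasure M (A N \<inter> A j))" .
  have "emeasure M (A N) + emeasure M ?U = emeasure M (A N \<union> ?U) + emeasure M (A N \<inter> ?U)"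
    using A by (intro emeasure_Un_Int) auto
  also have "A N \<union> ?U = (\<Union>i<Suc N. A i)" by (auto simp: lessThan_Suc)
  finally have 2: "emeasure M (A N) + emeasure M ?U = emeasure M (\<Union>i<Suc N. A i) + emeasure M (A N \<inter> ?U)" .
  have "(\<Sum>i<Suc N. emeasure M (A i)) \<le> emeasure M (A N) + (emeasure M ?U + (\<Sum>i<N. \<Sum>j<i. emeasure M (A i \<inter> A j)))"
    using Suc by (simp add: add.commute add_left_mono)
  also have "\<dots> = emeasure M (\<Union>i<Suc N. A i) + (emeasure M (A N \<inter> ?U) + (\<Sum>i<N. \<Sum>j<i. emeasure M (A i \<inter> A j)))"
    using 2 by (simp add: add.assoc[symmetric])
  also have "\<dots> \<le> emeasure M (\<Union>i<Suc N. A i) + ((\<Sum>j<N. emeasure M (A N \<inter> A j)) + (\<Sum>i<N. \<Sum>j<i. emeasure M (A i \<inter> A j)))"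
    by (intro add_left_mono add_right_mono 1)
  also have "\<dots> = emeasure M (\<Union>i<Suc N. A i) + (\<Sum>i<Suc N. \<Sum>j<i. emeasure M (A i \<inter> A j))"
    by (simp add: add.commute)
  finally show ?case .
qed simp

text \<open>A common point lets the height of \<open>a\<close> exceed that of \<open>b\<close> by at
  most \<open>h - 2 * l\<close>, whereas the drift asks for \<open>m * h\<close>. The defect is at
  least \<open>(m - 1) * h + 2 * l\<close>, hence at least \<open>m\<close>.\<close>

lemma cylinders_overlap:
  assumes unit: "norm e = 1" and z: "z - a \<in> cylinder e C l (h - l)" "z - b \<in> cylinder e C l (h - l)"
    and "h \<ge> 1" "l \<ge> 1" "m > 0"
  shows "real m \<le> norm (a - b - (real m * h) *\<^sub>R e)"
proof -
  have "(a - b) \<bullet> e = (z - b) \<bullet> e - (z - a) \<bullet> e" by (simp add: inner_diff_left)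
  then have "(a - b) \<bullet> e \<le> h - l - l" using z by (auto simp: cylinder_def)
  moreover have "(a - b - (real m * h) *\<^sub>R e) \<bullet> e = (a - b) \<bullet> e - real m * h"
    using unit by (simp add: inner_diff_left[of "a - b"] dot_square_norm)
  moreover have "(real m - 1) * 1 \<le> (real m - 1) * h"
    using \<open>m > 0\<close> \<open>h \<ge> 1\<close> by (intro mult_left_mono) auto
  ultimately have "(a - b - (real m * h) *\<^sub>R e) \<bullet> e \<le> - real m"
    using \<open>l \<ge> 1\<close> by (simp add: left_diff_distrib)
  then show ?thesis
    using abs_inner_unit_le[OF unit, of "a - b - (real m * h) *\<^sub>R e"] by simp
qed

text \<open>Markov's inequality in pathwise form. A wild piece loses a cylinder of volume
  \<open>V\<close>, and then its chaining sum divided by \<open>\<rho> ^ p\<close> is at least 1. An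
  overlap also costs at most \<open>V\<close>, and then the deviation divided by the lag
  \<open>i - j\<close> is at least 1. Replacing both indicators by these ratios leaves terms with
  computable expectation.\<close>

lemma emeasure_wiener_sausage_ge:
  fixes \<beta> :: "real \<Rightarrow> 'a::euclidean_space"
  assumes unit: "norm e = 1" and K: "compact K" "K \<subseteq> cball 0 R" and R: "R \<ge> 0" and \<epsilon>: "0 < \<epsilon>" "\<epsilon> \<le> 1"
    and v: "v * \<delta> \<ge> 1" and \<beta>: "continuous_on {0..real N * \<delta>} \<beta>" "\<delta> > 0" and "p > 0"
    and \<rho>: "\<rho> = \<epsilon> / (2 * chaining_const p)"
    and V: "V = emeasure lborel (cylinder e (inner_part e K \<epsilon>) (R + 1) (v * \<delta> - (R + 1)))"
  shows "of_nat N * V \<le> emeasure lborel (wiener_sausage K \<beta> (real N * \<delta>)) +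
    (\<Sum>i<N. V * ennreal (1 / \<rho> ^ p) * chaining_sum \<delta> p (\<lambda>u. \<beta> (real i * \<delta> + u) - (u * v) *\<^sub>R e)) +
    (\<Sum>i<N. \<Sum>j<i. V * ennreal (1 / real (i - j) ^ p *
      norm (\<beta> (real i * \<delta>) - \<beta> (real j * \<delta>) - (real (i - j) * (v * \<delta>)) *\<^sub>R e) ^ p))"
proof -
  define Z where "Z i = chaining_sum \<delta> p (\<lambda>u. \<beta> (real i * \<delta> + u) - (u * v) *\<^sub>R e)" for i
  define C where "C = cylinder e (inner_part e K \<epsilon>) (R + 1) (v * \<delta> - (R + 1))"
  \<comment> \<open>A wild piece contributes the empty set, so that each \<open>A i\<close> with
    \<open>i < N\<close> lies in the sausage of its piece and all overlaps are overlaps of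
    cylinders.\<close>
  define A where "A i = (if Z i \<le> ennreal (\<rho> ^ p) then {z. z - \<beta> (real i * \<delta>) \<in> C} else {})" for i
  have C: "C \<in> sets borel" unfolding C_def by measurable
  have VC: "V = emeasure lborel C" by (simp add: V C_def)
  note tr = emeasure_lborel_translation[OF C]
  have A_sets: "A i \<in> sets lborel" for i using tr(2) by (simp add: A_def)
  have Apos: "chaining_const p > 0" by (rule chaining_const_pos[OF \<open>p > 0\<close>])
  have \<rho>0: "\<rho> > 0" using \<epsilon> Apos by (simp add: \<rho>)
  have c: "continuous_on {0..\<delta>} (\<lambda>u. \<beta> (real i * \<delta> + u))" if "i < N" for i
    by (rule continuous_on_grid_piece[OF \<beta> that])
  have sub: "A i \<subseteq> wiener_sausage K (\<lambda>u. \<beta> (real i * \<delta> + u)) \<delta>" if "i < N" for i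
  proof (cases "Z i \<le> ennreal (\<rho> ^ p)")
    case True
    have fl: "norm (\<beta> (real i * \<delta> + u) - \<beta> (real i * \<delta> + 0) - (u * v) *\<^sub>R e) < \<epsilon>" if "u \<in> {0..\<delta>}" for u
    proof -
      have "norm (\<beta> (real i * \<delta> + u) - \<beta> (real i * \<delta> + 0) - (u * v) *\<^sub>R e) \<le> chaining_const p * \<rho>"
        using True that c[OF \<open>i < N\<close>] \<beta>(2) \<open>p > 0\<close> \<rho>0
        by (intro linear_drift_fluctuation[where f="\<lambda>u. \<beta> (real i * \<delta> + u)"]) (auto simp: Z_def)
      also have "\<dots> < \<epsilon>" using Apos \<epsilon> by (simp add: \<rho>)
      finally show ?thesis .
    qed
    show ?thesis
      using cylinder_subset_wiener_sausage[OF K unit \<epsilon>(2) \<beta>(2) c[OF that] fl] True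
      by (simp add: A_def C_def)
  qed (simp add: A_def)
  have V_le: "V \<le> emeasure lborel (A i) + V * ennreal (1 / \<rho> ^ p) * Z i" for i
  proof (cases "Z i \<le> ennreal (\<rho> ^ p)")
    case True
    then have "V = emeasure lborel (A i)" by (simp add: A_def tr VC)
    then show ?thesis by simp
  next
    case False
    have "1 = ennreal (1 / \<rho> ^ p) * ennreal (\<rho> ^ p)"
      using \<rho>0 by (simp flip: ennreal_mult)
    also have "\<dots> \<le> ennreal (1 / \<rho> ^ p) * Z i"
      using False by (intro mult_left_mono) auto
    finally have "V * 1 \<le> V * (ennreal (1 / \<rho> ^ p) * Z i)" by (intro mult_left_mono) auto
    then show ?thesis by (simp add: mult.assoc add_increasing)
  qed
  have overlap: "emeasure lborel (A i \<inter> A j) \<le> V * ennreal (1 / real (i - j) ^ p *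
      norm (\<beta> (real i * \<delta>) - \<beta> (real j * \<delta>) - (real (i - j) * (v * \<delta>)) *\<^sub>R e) ^ p)"
    (is "_ \<le> V * ennreal (1 / _ * ?n ^ p)") if "j < i" for i j
  proof (cases "A i \<inter> A j = {}")
    case False
    then obtain z where "z - \<beta> (real i * \<delta>) \<in> C" "z - \<beta> (real j * \<delta>) \<in> C"
      by (auto simp: A_def split: if_splits)
    then have "real (i - j) \<le> ?n"
      using that R v unfolding C_def
      by (intro cylinders_overlap[OF unit, where z=z and C="inner_part e K \<epsilon>" and l="R + 1"]) auto
    then have "real (i - j) ^ p \<le> ?n ^ p" by (intro power_mono) auto
    then have "1 \<le> 1 / real (i - j) ^ p * ?n ^ p" using that by (simp add: field_simps)
    then have "1 \<le> ennreal (1 / real (i - j) ^ p * ?n ^ p)"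
      by (simp only: ennreal_1[symmetric] ennreal_leI)
    then have "V * 1 \<le> V * ennreal (1 / real (i - j) ^ p * ?n ^ p)"
      by (intro mult_left_mono) auto
    moreover have "emeasure lborel (A i \<inter> A j) \<le> emeasure lborel {z. z - \<beta> (real i * \<delta>) \<in> C}"
      using tr(2) by (intro emeasure_mono) (auto simp: A_def)
    ultimately show ?thesis by (simp add: tr VC)
  qed simp
  have swap: "a + b + c = a + c + b" for a b c :: ennreal
    by (simp add: ac_simps)
  have "of_nat N * V = (\<Sum>i<N. V)" by simp
  also have "\<dots> \<le> (\<Sum>i<N. emeasure lborel (A i) + V * ennreal (1 / \<rho> ^ p) * Z i)"
    by (intro sum_mono V_le)
  also have "\<dots> = (\<Sum>i<N. emeasure lborel (A i)) + (\<Sum>i<N. V * ennreal (1 / \<rho> ^ p) * Z i)"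
    by (rule sum.distrib)
  also have "\<dots> \<le> emeasure lborel (\<Union>i<N. A i) + (\<Sum>i<N. \<Sum>j<i. emeasure lborel (A i \<inter> A j))
      + (\<Sum>i<N. V * ennreal (1 / \<rho> ^ p) * Z i)"
    by (intro add_right_mono bonferroni_emeasure A_sets)
  also have "\<dots> \<le> emeasure lborel (wiener_sausage K \<beta> (real N * \<delta>)) +
      (\<Sum>i<N. \<Sum>j<i. V * ennreal (1 / real (i - j) ^ p *
      norm (\<beta> (real i * \<delta>) - \<beta> (real j * \<delta>) - (real (i - j) * (v * \<delta>)) *\<^sub>R e) ^ p))
      + (\<Sum>i<N. V * ennreal (1 / \<rho> ^ p) * Z i)"
  proof (intro add_right_mono add_mono sum_mono overlap)
    show "emeasure lborel (\<Union>i<N. A i) \<le> emeasure lborel (wiener_sausage K \<beta> (real N * \<delta>))"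
      unfolding wiener_sausage_split[OF \<open>\<delta> > 0\<close>]
      using sub wiener_sausage_borel[OF K(1) c \<beta>(2)] by (intro emeasure_mono UN_mono) auto
  qed simp
  finally show ?thesis by (subst swap) (simp only: Z_def)
qed

section \<open>Measurability of the sausage volume\<close>

text \<open>A rational time need not hit \<open>K\<close>, but by continuity some rational time
  brings \<open>z - f q\<close> into any given neighbourhood of \<open>K\<close>. Conversely, such
  approximations put \<open>z\<close> into the closure of the sausage, which is closed. Countably
  many times then suffice for joint measurability.\<close>

lemma closed_sausage_iff_rational:
  assumes K: "compact K" and f: "continuous_on {0..r} f" and "r > 0"
  shows "z \<in> closed_sausage K f r \<longleftrightarrow>
    (\<forall>m::nat. \<exists>q\<in>\<rat> \<inter> {0..r}. z - f q \<in> (\<Union>k\<in>K. ball k (1 / real (Suc m))))"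
proof
  assume "z \<in> closed_sausage K f r"
  then obtain s where s: "s \<in> {0..r}" "z - f s \<in> K" by (auto simp: closed_sausage_def)
  show "\<forall>m::nat. \<exists>q\<in>\<rat> \<inter> {0..r}. z - f q \<in> (\<Union>k\<in>K. ball k (1 / real (Suc m)))"
  proof
    fix m :: nat
    obtain d where d: "d > 0" "\<And>s'. s' \<in> {0..r} \<Longrightarrow> dist s' s < d \<Longrightarrow> dist (f s') (f s) < 1 / real (Suc m)"
      using f s(1) unfolding continuous_on_iff by (metis of_nat_0_less_iff zero_less_Suc zero_less_divide_1_iff)
    \<comment> \<open>As \<open>r > 0\<close>, the times within \<open>d\<close> of \<open>s\<close>
      contain a nondegenerate open interval inside \<open>{0..r}\<close> even if \<open>s\<close> is
      an end point.\<close>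
    have "max 0 (s - d) < min r (s + d)" using s d \<open>r > 0\<close> by auto
    then obtain q where q: "q \<in> \<rat>" "max 0 (s - d) < q" "q < min r (s + d)"
      using Rats_dense_in_real by blast
    then have "dist (f q) (f s) < 1 / real (Suc m)"
      by (intro d(2)) (auto simp: dist_real_def)
    then have "z - f q \<in> ball (z - f s) (1 / real (Suc m))"
      by (simp add: dist_norm norm_minus_commute)
    then show "\<exists>q\<in>\<rat> \<inter> {0..r}. z - f q \<in> (\<Union>k\<in>K. ball k (1 / real (Suc m)))"
      using q s(2) by (intro bexI[of _ q] UN_I[of "z - f s"]) auto
  qed
next
  assume R: "\<forall>m::nat. \<exists>q\<in>\<rat> \<inter> {0..r}. z - f q \<in> (\<Union>k\<in>K. ball k (1 / real (Suc m)))"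
  have "closed (closed_sausage K f r)"
    by (intro compact_imp_closed compact_closed_sausage K f)
  moreover have "z \<in> closure (closed_sausage K f r)"
    unfolding closure_approachable
  proof safe
    fix e :: real assume "0 < e"
    then obtain m where m: "1 / real (Suc m) < e" using nat_approx_posE by blast
    obtain q k where q: "q \<in> {0..r}" "k \<in> K" "dist k (z - f q) < 1 / real (Suc m)"
      using R by (metis IntD2 UN_E mem_ball)
    have "dist (k + f q) z = dist k (z - f q)" by (simp add: dist_norm algebra_simps)
    moreover have "k + f q \<in> closed_sausage K f r"
      unfolding closed_sausage_def using q by (intro CollectI bexI[of _ q]) simp_all
    ultimately show "\<exists>y\<in>closed_sausage K f r. dist y z < e"
      using q(3) m by (intro bexI[of _ "k + f q"]) simp_all
  qed
  ultimately show "z \<in> closed_sausage K f r" by simp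
qed

lemma closed_sausage_measurable_pair:
  fixes X :: "real \<Rightarrow> 'v \<Rightarrow> 'a::euclidean_space"
  assumes K: "compact K" and "r > 0"
    and meas: "\<And>s. s \<in> {0..r} \<Longrightarrow> X s \<in> borel_measurable M"
    and cont: "\<And>\<omega>. \<omega> \<in> space M \<Longrightarrow> continuous_on {0..r} (\<lambda>s. X s \<omega>)"
  shows "{w \<in> space (M \<Otimes>\<^sub>M lborel). snd w \<in> closed_sausage K (\<lambda>s. X s (fst w)) r} \<in> sets (M \<Otimes>\<^sub>M lborel)"
proof -
  let ?V = "\<lambda>m::nat. \<Union>k\<in>K. ball k (1 / real (Suc m))"
  let ?P = "M \<Otimes>\<^sub>M (lborel :: 'a measure)"
  have "{w \<in> space ?P. snd w \<in> closed_sausage K (\<lambda>s. X s (fst w)) r} =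
      (\<Inter>m. \<Union>q\<in>\<rat> \<inter> {0..r}. (\<lambda>w. snd w - X q (fst w)) -` ?V m \<inter> space ?P)"
    (is "?L = ?R")
  proof (intro set_eqI iffI)
    fix w assume "w \<in> ?L"
    then have "fst w \<in> space M" "w \<in> space ?P" by (auto simp: space_pair_measure)
    then show "w \<in> ?R"
      using \<open>w \<in> ?L\<close> closed_sausage_iff_rational[OF K cont \<open>r > 0\<close>, of "fst w" "snd w"] by auto
  next
    fix w assume w: "w \<in> ?R"
    then have "w \<in> space ?P" by auto
    then have "fst w \<in> space M" by (auto simp: space_pair_measure)
    then show "w \<in> ?L"
      using w \<open>w \<in> space ?P\<close> closed_sausage_iff_rational[OF K cont \<open>r > 0\<close>, of "fst w" "snd w"] by auto
  qed
  also have "\<dots> \<in> sets ?P"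
  proof -
    have "(\<lambda>w. snd w - X q (fst w)) -` ?V m \<inter> space ?P \<in> sets ?P" if "q \<in> \<rat> \<inter> {0..r}" for m q
    proof -
      have [measurable]: "X q \<in> borel_measurable M" using that by (intro meas) auto
      have V: "?V m \<in> sets borel" by (intro borel_open open_UN) auto
      have "(\<lambda>w. snd w - X q (fst w)) \<in> borel_measurable ?P" by measurable
      then show ?thesis using V by (rule measurable_sets)
    qed
    then have "(\<Union>q\<in>\<rat> \<inter> {0..r}. (\<lambda>w. snd w - X q (fst w)) -` ?V m \<inter> space ?P) \<in> sets ?P" for m
      by (intro sets.countable_UN' countable_Int1 countable_rat image_subsetI)
    then show ?thesis by (intro sets.countable_INT) auto
  qed
  finally show ?thesis .
qed

text \<open>The volume is the measure of a section of a jointly measurable set, hence a measurable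
  function of \<open>\<omega>\<close>.\<close>

lemma wiener_sausage_volume_measurable:
  fixes X :: "real \<Rightarrow> 'v \<Rightarrow> 'a::euclidean_space"
  assumes K: "compact K" and "t > 0"
    and meas: "\<And>s. s \<in> {0..t} \<Longrightarrow> X s \<in> borel_measurable M"
    and cont: "\<And>\<omega>. \<omega> \<in> space M \<Longrightarrow> continuous_on {0..t} (\<lambda>s. X s \<omega>)"
  shows "(\<lambda>\<omega>. emeasure lborel (wiener_sausage K (\<lambda>s. X s \<omega>) t)) \<in> borel_measurable M"
proof -
  let ?P = "M \<Otimes>\<^sub>M (lborel :: 'a measure)"
  let ?r = "\<lambda>n. t - t / real (n + 2)"
  have r: "?r n > 0" "?r n \<le> t" for n
    using \<open>t > 0\<close> by (auto simp: field_simps intro: add_pos_nonneg)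
  define Q where "Q = (\<Union>n. {w \<in> space ?P. snd w \<in> closed_sausage K (\<lambda>s. X s (fst w)) (?r n)})"
  have "{w \<in> space ?P. snd w \<in> closed_sausage K (\<lambda>s. X s (fst w)) (?r n)} \<in> sets ?P" for n
    using r[of n] by (intro closed_sausage_measurable_pair K meas continuous_on_subset[OF cont]) auto
  then have "Q \<in> sets ?P" unfolding Q_def by (intro sets.countable_UN) auto
  then have "(\<lambda>\<omega>. emeasure lborel (Pair \<omega> -` Q)) \<in> borel_measurable M"
    by (rule lborel.measurable_emeasure_Pair)
  moreover have "Pair \<omega> -` Q = wiener_sausage K (\<lambda>s. X s \<omega>) t" if "\<omega> \<in> space M" for \<omega>
    using that by (auto simp: Q_def wiener_sausage_eq_UN[OF \<open>t > 0\<close>] space_pair_measure)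
  ultimately show ?thesis
    by (subst measurable_cong[of M _ "\<lambda>\<omega>. emeasure lborel (Pair \<omega> -` Q)"]) simp_all
qed

section \<open>Expected volume of the sausage of a bridge\<close>

lemma gaussian_moment_const_nonneg: "gaussian_moment_const TYPE('a::euclidean_space) q \<ge> 0"
  by (simp add: gaussian_moment_const_def)

text \<open>The sharper bound \<open>2 - 1 / n\<close> telescopes. At \<open>n = 0\<close> it reads
  \<open>0 <= 2\<close> because \<open>1 / 0 = 0\<close>, so the step from 0 to 1 is treated
  apart.\<close>

lemma sum_inverse_squares_le: "(\<Sum>j<i. 1 / real (i - j) ^ 2) \<le> 2"
proof -
  have S: "(\<Sum>m<n. 1 / real (Suc m) ^ 2) \<le> 2 - 1 / real n" for n
  proof (induction n)
    case (Suc n)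
    show ?case
    proof (cases "n = 0")
      case False
      then have "1 / real n - 1 / real (Suc n) = 1 / (real n * real (Suc n))"
        by (simp add: field_simps)
      also have "\<dots> \<ge> 1 / real (Suc n) ^ 2"
        using False unfolding power2_eq_square by (intro divide_left_mono mult_right_mono) auto
      finally have "1 / real (Suc n) ^ 2 \<le> 1 / real n - 1 / real (Suc n)" .
      then show ?thesis using Suc by simp
    qed simp
  qed simp
  have "(\<Sum>j<i. 1 / real (i - j) ^ 2) = (\<Sum>j<i. 1 / real (Suc (i - Suc j)) ^ 2)"
    by (intro sum.cong) (auto simp: Suc_diff_Suc)
  also have "\<dots> = (\<Sum>m<i. 1 / real (Suc m) ^ 2)"
    by (rule sum.nat_diff_reindex)
  also have "\<dots> \<le> 2 - 1 / real i" by (rule S)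
  also have "\<dots> \<le> 2" by simp
  finally show ?thesis .
qed

text \<open>The chaining bound with \<open>p = 2 * d\<close> and \<open>q = d\<close>; the dimension
  condition supplies \<open>q >= 2\<close>. The subtracted drift is exactly the mean of the bridge
  increments.\<close>

lemma bridge_chaining_sum_expectation:
  fixes X :: "real \<Rightarrow> 'v \<Rightarrow> 'a::euclidean_space"
  assumes bridge: "brownian_bridge M X 0 (x *\<^sub>R e) t" and t: "t = real N * \<delta>" and \<delta>: "\<delta> > 0" and "i < N"
    and "DIM('a) \<ge> 2"
  defines "Z \<equiv> \<lambda>\<omega>. chaining_sum \<delta> (2 * DIM('a)) (\<lambda>u. X (real i * \<delta> + u) \<omega> - (u * (x / t)) *\<^sub>R e)"
  shows "Z \<in> borel_measurable M"
    and "(\<integral>\<^sup>+\<omega>. Z \<omega> \<partial>M) \<le> ennreal (4 * gaussian_moment_const TYPE('a) DIM('a) * \<delta> ^ DIM('a))"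
proof -
  define Y where "Y u \<omega> = X (real i * \<delta> + u) \<omega> - (u * (x / t)) *\<^sub>R e" for u \<omega>
  have grid: "real i * \<delta> + u \<in> {0..t}" if "u \<in> {0..\<delta>}" for u
    using grid_bounds[OF \<open>i < N\<close> that \<delta>] by (simp add: t)
  have meas: "Y u \<in> borel_measurable M" if "u \<in> {0..\<delta>}" for u
  proof -
    have [measurable]: "X (real i * \<delta> + u) \<in> borel_measurable M"
      using bridge grid[OF that] unfolding brownian_bridge_def by blast
    show ?thesis unfolding Y_def by measurable
  qed
  have mom: "(\<integral>\<^sup>+\<omega>. ennreal (norm (Y r \<omega> - Y s \<omega>) ^ (2 * DIM('a))) \<partial>M)
      \<le> ennreal (gaussian_moment_const TYPE('a) DIM('a) * (r - s) ^ DIM('a))"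
    if "0 \<le> s" "s < r" "r \<le> \<delta>" for s r
  proof -
    have "(real i * \<delta> + r - (real i * \<delta> + s)) / t * x = r * (x / t) - s * (x / t)"
      by (simp add: diff_divide_distrib left_diff_distrib)
    then have sc: "((real i * \<delta> + r - (real i * \<delta> + s)) / t) *\<^sub>R (x *\<^sub>R e) =
        (r * (x / t)) *\<^sub>R e - (s * (x / t)) *\<^sub>R e"
      by (simp only: scaleR_scaleR scaleR_diff_left)
    have "Y r \<omega> - Y s \<omega> = X (real i * \<delta> + r) \<omega> - X (real i * \<delta> + s) \<omega> -
        ((real i * \<delta> + r - (real i * \<delta> + s)) / t) *\<^sub>R (x *\<^sub>R e)" for \<omega>
      unfolding Y_def sc by simp
    then show ?thesis
      using brownian_bridge_increment_moment[OF bridge, of "real i * \<delta> + s" "real i * \<delta> + r" "DIM('a)"]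
        that grid[of s] grid[of r] by simp
  qed
  show "Z \<in> borel_measurable M"
    unfolding Z_def Y_def[symmetric]
    by (rule chaining_sum_expectation(1)[OF meas mom]) (use \<delta> assms(5) gaussian_moment_const_nonneg in auto)
  show "(\<integral>\<^sup>+\<omega>. Z \<omega> \<partial>M) \<le> ennreal (4 * gaussian_moment_const TYPE('a) DIM('a) * \<delta> ^ DIM('a))"
    unfolding Z_def Y_def[symmetric]
    by (rule chaining_sum_expectation(2)[OF meas mom]) (use \<delta> assms(5) gaussian_moment_const_nonneg in auto)
qed

text \<open>Over the lag \<open>m = i - j\<close> the moment is of order
  \<open>(m * \<delta>) ^ d\<close>. Division by \<open>m ^ (2 * d)\<close> leaves
  \<open>1 / m ^ d\<close>, at most \<open>1 / m ^ 2\<close>, whose sum over the lags is bounded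
  independently of \<open>N\<close>.\<close>

lemma bridge_grid_increment_expectation:
  fixes X :: "real \<Rightarrow> 'v \<Rightarrow> 'a::euclidean_space"
  assumes bridge: "brownian_bridge M X 0 (x *\<^sub>R e) t" and t: "t = real N * \<delta>" and \<delta>: "\<delta> > 0"
    and "j < i" "i < N" and "DIM('a) \<ge> 2"
  defines "D \<equiv> \<lambda>\<omega>. ennreal (1 / real (i - j) ^ (2 * DIM('a)) *
    norm (X (real i * \<delta>) \<omega> - X (real j * \<delta>) \<omega> - (real (i - j) * (x / t * \<delta>)) *\<^sub>R e) ^ (2 * DIM('a)))"
  shows "D \<in> borel_measurable M"
    and "(\<integral>\<^sup>+\<omega>. D \<omega> \<partial>M) \<le>
      ennreal (gaussian_moment_const TYPE('a) DIM('a) * \<delta> ^ DIM('a) * (1 / real (i - j) ^ 2))"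
proof -
  let ?d = "DIM('a)" and ?c = "gaussian_moment_const TYPE('a) DIM('a)"
  define m where "m = real (i - j)"
  have m: "m \<ge> 1" "m = real i - real j" using \<open>j < i\<close> by (auto simp: m_def)
  have grid: "real k * \<delta> \<in> {0..t}" if "k < N" for k
    using grid_bounds[of k N 0 \<delta>] that \<delta> by (simp add: t)
  have Xm [measurable]: "X (real i * \<delta>) \<in> borel_measurable M" "X (real j * \<delta>) \<in> borel_measurable M"
    using bridge grid[of i] grid[of j] \<open>j < i\<close> \<open>i < N\<close> unfolding brownian_bridge_def by auto
  show "D \<in> borel_measurable M" unfolding D_def by measurable
  let ?n = "\<lambda>\<omega>. norm (X (real i * \<delta>) \<omega> - X (real j * \<delta>) \<omega> - (m * (x / t * \<delta>)) *\<^sub>R e)"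
  have "(\<integral>\<^sup>+\<omega>. D \<omega> \<partial>M) = (\<integral>\<^sup>+\<omega>. ennreal (1 / m ^ (2 * ?d)) * ennreal (?n \<omega> ^ (2 * ?d)) \<partial>M)"
    unfolding D_def m_def[symmetric] using m by (intro nn_integral_cong) (simp flip: ennreal_mult)
  also have "\<dots> = ennreal (1 / m ^ (2 * ?d)) * (\<integral>\<^sup>+\<omega>. ennreal (?n \<omega> ^ (2 * ?d)) \<partial>M)"
    by (intro nn_integral_cmult) measurable
  also have "\<dots> \<le> ennreal (1 / m ^ (2 * ?d)) * ennreal (?c * (m * \<delta>) ^ ?d)"
  proof (rule mult_left_mono)
    have m\<delta>: "real i * \<delta> - real j * \<delta> = m * \<delta>"
      by (simp add: m(2) left_diff_distrib)
    then have "m * (x / t * \<delta>) = (real i * \<delta> - real j * \<delta>) / t * x" by simp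
    then have "?n \<omega> = norm (X (real i * \<delta>) \<omega> - X (real j * \<delta>) \<omega> -
        ((real i * \<delta> - real j * \<delta>) / t) *\<^sub>R (x *\<^sub>R e))" for \<omega>
      by (simp only: scaleR_scaleR)
    then show "(\<integral>\<^sup>+\<omega>. ennreal (?n \<omega> ^ (2 * ?d)) \<partial>M) \<le> ennreal (?c * (m * \<delta>) ^ ?d)"
      using brownian_bridge_increment_moment[OF bridge, of "real j * \<delta>" "real i * \<delta>" ?d]
        grid[of i] \<open>j < i\<close> \<open>i < N\<close> \<delta> by (simp add: m\<delta>)
  qed simp
  also have "ennreal (1 / m ^ (2 * ?d)) * ennreal (?c * (m * \<delta>) ^ ?d) =
      ennreal (1 / m ^ (2 * ?d) * (?c * (m * \<delta>) ^ ?d))"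
    using m gaussian_moment_const_nonneg[where 'a='a] \<delta> by (intro ennreal_mult[symmetric]) auto
  also have "\<dots> \<le> ennreal (?c * \<delta> ^ ?d * (1 / m ^ 2))"
  proof (rule ennreal_leI)
    have "1 / m ^ (2 * ?d) * (?c * (m * \<delta>) ^ ?d) = ?c * \<delta> ^ ?d * (1 / m ^ ?d)"
      using m unfolding mult_2 power_add power_mult_distrib by simp
    also have "\<dots> \<le> ?c * \<delta> ^ ?d * (1 / m ^ 2)"
      using m gaussian_moment_const_nonneg[where 'a='a] \<delta> \<open>?d \<ge> 2\<close>
      by (intro mult_left_mono divide_left_mono power_increasing) auto
    finally show "1 / m ^ (2 * ?d) * (?c * (m * \<delta>) ^ ?d) \<le> ?c * \<delta> ^ ?d * (1 / m ^ 2)" .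
  qed
  finally show "(\<integral>\<^sup>+\<omega>. D \<omega> \<partial>M) \<le> ennreal (?c * \<delta> ^ ?d * (1 / real (i - j) ^ 2))"
    by (simp only: m_def)
qed

lemma nn_integral_wiener_sausage_le:
  fixes X :: "real \<Rightarrow> 'v \<Rightarrow> 'a::euclidean_space"
  assumes bridge: "brownian_bridge M X 0 (x *\<^sub>R e) t" and t: "t = real N * \<delta>" and \<delta>: "\<delta> > 0" and "N > 0"
    and dim: "DIM('a) \<ge> 2" and unit: "norm e = 1" and K: "compact K" "K \<subseteq> cball 0 R" and R: "R \<ge> 0"
    and \<epsilon>: "0 < \<epsilon>" "\<epsilon> \<le> 1" and x: "x \<ge> 0" "x / t * \<delta> \<le> \<Lambda>"
    and \<rho>: "\<rho> = \<epsilon> / (2 * chaining_const (2 * DIM('a)))"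
  shows "(\<integral>\<^sup>+\<omega>. emeasure lborel (wiener_sausage K (\<lambda>s. X s \<omega>) t) \<partial>M) \<le>
    ennreal (real N * (measure (perp_lborel e) (outer_part e K \<epsilon>) * (x / t * \<delta> + 2 * (R + 1)) +
      bad_volume_const TYPE('a) (2 * DIM('a)) \<rho> (R + \<Lambda>) *
        (4 * gaussian_moment_const TYPE('a) DIM('a) * \<delta> ^ DIM('a))))"
proof -
  interpret prob_space M using bridge by (simp add: brownian_bridge_def)
  have t0: "t > 0" using t \<delta> \<open>N > 0\<close> by simp
  have v: "x / t \<ge> 0" using x t0 by simp
  let ?p = "2 * DIM('a)"
  let ?C = "bad_volume_const TYPE('a) ?p \<rho> (R + \<Lambda>)"
  let ?E = "4 * gaussian_moment_const TYPE('a) DIM('a) * \<delta> ^ DIM('a)"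
  let ?G = "measure (perp_lborel e) (outer_part e K \<epsilon>) * (x / t * \<delta> + 2 * (R + 1))"
  let ?Z = "\<lambda>i \<omega>. chaining_sum \<delta> ?p (\<lambda>u. X (real i * \<delta> + u) \<omega> - (u * (x / t)) *\<^sub>R e)"
  note Z = bridge_chaining_sum_expectation[OF bridge t \<delta> _ dim]
  have v\<delta>: "0 \<le> x / t * \<delta>" using v less_imp_le[OF \<delta>] by (rule mult_nonneg_nonneg)
  moreover have "0 \<le> 2 * (R + 1)" using R by simp
  ultimately have vR: "0 \<le> x / t * \<delta> + 2 * (R + 1)" by (rule add_nonneg_nonneg)
  then have G0: "?G \<ge> 0" by (intro mult_nonneg_nonneg) simp_all
  have C0: "?C \<ge> 0"
  proof (rule less_imp_le, rule bad_volume_const_pos)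
    show "\<rho> > 0" using \<epsilon> chaining_const_pos[of ?p] by (simp add: \<rho>)
    show "0 \<le> R + \<Lambda>" using order_trans[OF v\<delta> x(2)] R by simp
  qed simp
  have E0: "?E \<ge> 0" using gaussian_moment_const_nonneg[where 'a='a] \<delta> by simp
  have bnd: "bounded (outer_part e K \<epsilon>)"
  proof (rule bounded_subset[OF bounded_cball[of 0 "R + \<epsilon>"]], safe)
    fix w assume "w \<in> outer_part e K \<epsilon>"
    then obtain k where k: "k \<in> K" "dist (perp_proj e k) w < \<epsilon>" by (auto simp: outer_part_def)
    have "norm w \<le> norm (perp_proj e k) + dist (perp_proj e k) w"
      using norm_triangle_sub[of w "perp_proj e k"] by (simp add: dist_norm norm_minus_commute)
    also have "\<dots> \<le> R + \<epsilon>" using norm_perp_proj_le[OF unit, of k] k K(2) by force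
    finally show "w \<in> cball 0 (R + \<epsilon>)" by simp
  qed
  then have fin: "emeasure (perp_lborel e) (outer_part e K \<epsilon>) = ennreal (measure (perp_lborel e) (outer_part e K \<epsilon>))"
    using emeasure_perp_lborel_bounded[OF unit sets_outer_part bnd]
    by (intro emeasure_eq_ennreal_measure) auto
  have "(\<integral>\<^sup>+\<omega>. emeasure lborel (wiener_sausage K (\<lambda>s. X s \<omega>) t) \<partial>M)
      \<le> (\<integral>\<^sup>+\<omega>. (\<Sum>i<N. ennreal ?G + ennreal ?C * ?Z i \<omega>) \<partial>M)"
  proof (rule nn_integral_mono)
    fix \<omega> assume "\<omega> \<in> space M"
    then have "continuous_on {0..real N * \<delta>} (\<lambda>s. X s \<omega>)"
      using bridge by (simp add: brownian_bridge_def t)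
    from emeasure_wiener_sausage_le[OF unit K R \<epsilon> v x(2) this \<delta> refl \<rho>]
    show "emeasure lborel (wiener_sausage K (\<lambda>s. X s \<omega>) t) \<le> (\<Sum>i<N. ennreal ?G + ennreal ?C * ?Z i \<omega>)"
      unfolding fin t[symmetric] ennreal_mult[OF measure_nonneg vR, symmetric] .
  qed
  also have "\<dots> = (\<Sum>i<N. \<integral>\<^sup>+\<omega>. ennreal ?G + ennreal ?C * ?Z i \<omega> \<partial>M)"
    using Z(1) by (intro nn_integral_sum) auto
  also have "\<dots> = (\<Sum>i<N. ennreal ?G + ennreal ?C * (\<integral>\<^sup>+\<omega>. ?Z i \<omega> \<partial>M))"
    using Z(1) by (intro sum.cong) (auto simp: nn_integral_add nn_integral_cmult emeasure_space_1)
  also have "\<dots> \<le> (\<Sum>i<N. ennreal ?G + ennreal ?C * ennreal ?E)"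
    using Z(2) by (intro sum_mono add_left_mono mult_left_mono) auto
  also have "\<dots> = (\<Sum>i<N. ennreal (?G + ?C * ?E))"
    using G0 C0 E0 by (simp add: ennreal_plus ennreal_mult)
  also have "\<dots> = ennreal (real N * (?G + ?C * ?E))"
    using G0 C0 E0 by (subst sum_ennreal) auto
  finally show ?thesis .
qed

text \<open>In the error factor, \<open>4 / \<rho> ^ (2 * d)\<close> comes from the lost pieces and
  2 from the inverse squares of the lags. The error is proportional to \<open>N * V\<close>, so it
  is a small fraction of the left-hand side when \<open>\<delta>\<close> is small.\<close>

lemma nn_integral_wiener_sausage_ge:
  fixes X :: "real \<Rightarrow> 'v \<Rightarrow> 'a::euclidean_space"
  assumes bridge: "brownian_bridge M X 0 (x *\<^sub>R e) t" and t: "t = real N * \<delta>" and \<delta>: "\<delta> > 0" and "N > 0"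
    and dim: "DIM('a) \<ge> 2" and unit: "norm e = 1" and K: "compact K" "K \<subseteq> cball 0 R" and R: "R \<ge> 0"
    and \<epsilon>: "0 < \<epsilon>" "\<epsilon> \<le> 1" and x: "x / t * \<delta> \<ge> 2 * (R + 1)"
    and \<rho>: "\<rho> = \<epsilon> / (2 * chaining_const (2 * DIM('a)))"
    and V: "V = measure (perp_lborel e) (inner_part e K \<epsilon>) * (x / t * \<delta> - 2 * (R + 1))"
    and fin: "emeasure (perp_lborel e) (inner_part e K \<epsilon>) < \<infinity>"
  shows "ennreal (real N * V) \<le> (\<integral>\<^sup>+\<omega>. emeasure lborel (wiener_sausage K (\<lambda>s. X s \<omega>) t) \<partial>M) +
    ennreal (real N * V * (4 / \<rho> ^ (2 * DIM('a)) + 2) * (gaussian_moment_const TYPE('a) DIM('a) * \<delta> ^ DIM('a)))"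
proof -
  interpret prob_space M using bridge by (simp add: brownian_bridge_def)
  have t0: "t > 0" using t \<delta> \<open>N > 0\<close> by simp
  let ?p = "2 * DIM('a)"
  let ?c = "gaussian_moment_const TYPE('a) DIM('a) * \<delta> ^ DIM('a)"
  let ?Z = "\<lambda>i \<omega>. chaining_sum \<delta> ?p (\<lambda>u. X (real i * \<delta> + u) \<omega> - (u * (x / t)) *\<^sub>R e)"
  let ?D = "\<lambda>i j \<omega>. ennreal (1 / real (i - j) ^ ?p *
    norm (X (real i * \<delta>) \<omega> - X (real j * \<delta>) \<omega> - (real (i - j) * (x / t * \<delta>)) *\<^sub>R e) ^ ?p)"
  let ?S = "\<lambda>\<omega>. emeasure lborel (wiener_sausage K (\<lambda>s. X s \<omega>) t)"
  have \<rho>0: "\<rho> > 0" using \<epsilon> chaining_const_pos[of ?p] by (simp add: \<rho>)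
  note Z = bridge_chaining_sum_expectation[OF bridge t \<delta> _ dim]
  note D = bridge_grid_increment_expectation[OF bridge t \<delta> _ _ dim]
  have V0: "V \<ge> 0" using x by (simp add: V)
  have c0: "?c \<ge> 0" using gaussian_moment_const_nonneg[where 'a='a] \<delta> by simp
  have fin': "emeasure (perp_lborel e) (inner_part e K \<epsilon>) = ennreal (measure (perp_lborel e) (inner_part e K \<epsilon>))"
    using fin by (intro emeasure_eq_ennreal_measure) auto
  have "emeasure lborel (cylinder e (inner_part e K \<epsilon>) (R + 1) (x / t * \<delta> - (R + 1))) =
      emeasure (perp_lborel e) (inner_part e K \<epsilon>) * ennreal (x / t * \<delta> - (R + 1) - (R + 1))"
    using x by (intro emeasure_cylinder[OF unit]) auto
  also have "x / t * \<delta> - (R + 1) - (R + 1) = x / t * \<delta> - 2 * (R + 1)" by simp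
  also have "emeasure (perp_lborel e) (inner_part e K \<epsilon>) * ennreal (x / t * \<delta> - 2 * (R + 1)) = ennreal V"
    unfolding fin' V using x by (intro ennreal_mult[symmetric]) auto
  finally have V': "emeasure lborel (cylinder e (inner_part e K \<epsilon>) (R + 1) (x / t * \<delta> - (R + 1))) = ennreal V" .
  have v: "x / t * \<delta> \<ge> 1" using R by (intro order_trans[OF _ x]) simp
  have Sm: "?S \<in> borel_measurable M"
    using bridge by (intro wiener_sausage_volume_measurable K t0) (auto simp: brownian_bridge_def)
  have Zm: "(\<lambda>\<omega>. \<Sum>i<N. ennreal V * ennreal (1 / \<rho> ^ ?p) * ?Z i \<omega>) \<in> borel_measurable M"
    using Z(1) by (intro borel_measurable_sum borel_measurable_times_ennreal) auto
  have Dm: "(\<lambda>\<omega>. \<Sum>j<i. ennreal V * ?D i j \<omega>) \<in> borel_measurable M" if "i < N" for i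
    using D(1) that by (intro borel_measurable_sum borel_measurable_times_ennreal) auto
  have "ennreal (real N * V) = of_nat N * ennreal V"
    using V0 by (simp add: ennreal_mult ennreal_of_nat_eq_real_of_nat)
  also have "\<dots> = (\<integral>\<^sup>+\<omega>. of_nat N * ennreal V \<partial>M)"
    by (simp add: emeasure_space_1)
  also have "\<dots> \<le> (\<integral>\<^sup>+\<omega>. ?S \<omega> + (\<Sum>i<N. ennreal V * ennreal (1 / \<rho> ^ ?p) * ?Z i \<omega>)
      + (\<Sum>i<N. \<Sum>j<i. ennreal V * ?D i j \<omega>) \<partial>M)"
  proof (rule nn_integral_mono)
    fix \<omega> assume "\<omega> \<in> space M"
    then have "continuous_on {0..real N * \<delta>} (\<lambda>s. X s \<omega>)"
      using bridge by (simp add: brownian_bridge_def t)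
    from emeasure_wiener_sausage_ge[OF unit K R \<epsilon> v this \<delta> _ \<rho> V'[symmetric]]
    show "of_nat N * ennreal V \<le> ?S \<omega> + (\<Sum>i<N. ennreal V * ennreal (1 / \<rho> ^ ?p) * ?Z i \<omega>)
      + (\<Sum>i<N. \<Sum>j<i. ennreal V * ?D i j \<omega>)"
      unfolding t[symmetric] by simp
  qed
  also have "\<dots> = (\<integral>\<^sup>+\<omega>. ?S \<omega> \<partial>M) + (\<integral>\<^sup>+\<omega>. (\<Sum>i<N. ennreal V * ennreal (1 / \<rho> ^ ?p) * ?Z i \<omega>) \<partial>M)
      + (\<integral>\<^sup>+\<omega>. (\<Sum>i<N. \<Sum>j<i. ennreal V * ?D i j \<omega>) \<partial>M)"
    using Sm Zm Dm
    by (subst nn_integral_add, simp_all add: borel_measurable_sum)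
       (subst nn_integral_add, simp_all)
  also have "(\<integral>\<^sup>+\<omega>. (\<Sum>i<N. ennreal V * ennreal (1 / \<rho> ^ ?p) * ?Z i \<omega>) \<partial>M)
      = (\<Sum>i<N. ennreal V * ennreal (1 / \<rho> ^ ?p) * (\<integral>\<^sup>+\<omega>. ?Z i \<omega> \<partial>M))"
    using Z(1) by (subst nn_integral_sum) (auto intro!: sum.cong nn_integral_cmult)
  also have "\<dots> \<le> (\<Sum>i<N. ennreal V * ennreal (1 / \<rho> ^ ?p) * ennreal (4 * ?c))"
    using Z(2) by (intro sum_mono mult_left_mono) (auto simp: mult.assoc)
  also have "\<dots> = ennreal (real N * V * (4 / \<rho> ^ ?p) * ?c)"
    using V0 \<rho>0 c0 by (simp add: ennreal_mult[symmetric] sum_ennreal del: sum_constant) (simp add: field_simps)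
  also have "(\<integral>\<^sup>+\<omega>. (\<Sum>i<N. \<Sum>j<i. ennreal V * ?D i j \<omega>) \<partial>M)
      = (\<Sum>i<N. \<Sum>j<i. ennreal V * (\<integral>\<^sup>+\<omega>. ?D i j \<omega> \<partial>M))"
  proof (subst nn_integral_sum)
    show "(\<Sum>i<N. \<integral>\<^sup>+\<omega>. (\<Sum>j<i. ennreal V * ?D i j \<omega>) \<partial>M) = (\<Sum>i<N. \<Sum>j<i. ennreal V * (\<integral>\<^sup>+\<omega>. ?D i j \<omega> \<partial>M))"
    proof (rule sum.cong[OF refl])
      fix i assume i: "i \<in> {..<N}"
      have "(\<integral>\<^sup>+\<omega>. (\<Sum>j<i. ennreal V * ?D i j \<omega>) \<partial>M) = (\<Sum>j<i. \<integral>\<^sup>+\<omega>. ennreal V * ?D i j \<omega> \<partial>M)"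
        using D(1) i by (intro nn_integral_sum borel_measurable_times_ennreal) auto
      also have "\<dots> = (\<Sum>j<i. ennreal V * (\<integral>\<^sup>+\<omega>. ?D i j \<omega> \<partial>M))"
        using D(1) i by (intro sum.cong nn_integral_cmult) auto
      finally show "(\<integral>\<^sup>+\<omega>. (\<Sum>j<i. ennreal V * ?D i j \<omega>) \<partial>M) = (\<Sum>j<i. ennreal V * (\<integral>\<^sup>+\<omega>. ?D i j \<omega> \<partial>M))" .
    qed
  qed (use Dm in auto)
  also have "\<dots> \<le> (\<Sum>i<N. ennreal (V * (?c * 2)))"
  proof (rule sum_mono)
    fix i assume i: "i \<in> {..<N}"
    have "(\<Sum>j<i. ennreal V * (\<integral>\<^sup>+\<omega>. ?D i j \<omega> \<partial>M)) \<le> (\<Sum>j<i. ennreal V * ennreal (?c * (1 / real (i - j) ^ 2)))"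
      using D(2) i by (intro sum_mono mult_left_mono) auto
    also have "\<dots> = (\<Sum>j<i. ennreal (V * (?c * (1 / real (i - j) ^ 2))))"
      using V0 c0 by (intro sum.cong refl ennreal_mult[symmetric]) auto
    also have "\<dots> = ennreal (\<Sum>j<i. V * (?c * (1 / real (i - j) ^ 2)))"
      using V0 c0 by (intro sum_ennreal) auto
    also have "\<dots> \<le> ennreal (V * (?c * 2))"
      using V0 c0 sum_inverse_squares_le[of i]
      unfolding sum_distrib_left[symmetric] by (intro ennreal_leI mult_left_mono) auto
    finally show "(\<Sum>j<i. ennreal V * (\<integral>\<^sup>+\<omega>. ?D i j \<omega> \<partial>M)) \<le> ennreal (V * (?c * 2))" .
  qed
  also have "\<dots> = ennreal (real N * V * 2 * ?c)"
    using V0 c0 by (subst sum_ennreal) (auto simp: field_simps)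
  finally have "ennreal (real N * V) \<le> (\<integral>\<^sup>+\<omega>. ?S \<omega> \<partial>M) + ennreal (real N * V * (4 / \<rho> ^ ?p) * ?c)
      + ennreal (real N * V * 2 * ?c)"
    by (auto intro: add_mono)
  also have "\<dots> = (\<integral>\<^sup>+\<omega>. ?S \<omega> \<partial>M) + ennreal (real N * V * (4 / \<rho> ^ ?p + 2) * ?c)"
    using V0 c0 \<rho>0 by (simp add: add.assoc ennreal_plus[symmetric] distrib_left distrib_right del: ennreal_plus)
  finally show ?thesis .
qed

section \<open>Letting the margin tend to zero\<close>

text \<open>The projection is compact, hence the intersection of its neighbourhoods. These have
  finite measure, so continuity from above applies, and monotonicity extends the estimate to all
  smaller \<open>\<epsilon>\<close>.\<close>

lemma ex_outer_part_measure_le: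
  assumes K: "compact K" and unit: "norm e = 1" and "\<eta> > 0"
  shows "\<exists>\<epsilon>0>0. \<forall>\<epsilon>. 0 < \<epsilon> \<and> \<epsilon> \<le> \<epsilon>0 \<longrightarrow>
    measure (perp_lborel e) (outer_part e K \<epsilon>) \<le> measure (perp_lborel e) (perp_proj e ` K) + \<eta>"
proof -
  let ?M = "perp_lborel e" and ?A = "\<lambda>n. outer_part e K (1 / real (Suc n))"
  have mono: "outer_part e K a \<subseteq> outer_part e K b" if "a \<le> b" for a b
    unfolding outer_part_def using subset_ball[OF that] by blast
  have fin: "emeasure ?M (outer_part e K a) < \<infinity>" for a
  proof (intro emeasure_perp_lborel_bounded[OF unit sets_outer_part])
    obtain r where r: "\<And>y. y \<in> perp_proj e ` K \<Longrightarrow> norm y \<le> r"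
      using compact_imp_bounded[OF compact_perp_proj[OF K, of e]] unfolding bounded_iff by blast
    show "bounded (outer_part e K a)"
    proof (rule bounded_subset[OF bounded_cball[of 0 "r + a"]], safe)
      fix w assume "w \<in> outer_part e K a"
      then obtain y where y: "y \<in> perp_proj e ` K" "dist y w < a" by (auto simp: outer_part_def)
      then show "w \<in> cball 0 (r + a)"
        using norm_triangle_sub[of w y] r[OF y(1)] by (simp add: dist_norm norm_minus_commute)
    qed
  qed
  have "(\<Inter>n. ?A n) = perp_proj e ` K"
  proof
    show "(\<Inter>n. ?A n) \<subseteq> perp_proj e ` K"
    proof
      fix y assume y: "y \<in> (\<Inter>n. ?A n)"
      have "y \<in> closure (perp_proj e ` K)"
        unfolding closure_approachable
      proof safe
        fix a :: real assume "0 < a"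
        then obtain n where n: "1 / real (Suc n) < a" using nat_approx_posE by blast
        have "y \<in> ?A n" using y by blast
        then show "\<exists>w\<in>perp_proj e ` K. dist w y < a"
          unfolding outer_part_def using n by (auto intro: less_trans)
      qed
      then show "y \<in> perp_proj e ` K"
        using compact_imp_closed[OF compact_perp_proj[OF K, of e]] by simp
    qed
  qed (auto simp: outer_part_def)
  moreover have "(\<lambda>n. measure ?M (?A n)) \<longlonglongrightarrow> measure ?M (\<Inter>n. ?A n)"
  proof (intro Lim_measure_decseq)
    show "decseq ?A"
      by (intro decseq_SucI mono) (simp add: frac_le)
  qed (use fin in \<open>auto simp: less_top\<close>)
  ultimately have "(\<lambda>n. measure ?M (?A n)) \<longlonglongrightarrow> measure ?M (perp_proj e ` K)" by simp
  from order_tendstoD(2)[OF this, of "measure ?M (perp_proj e ` K) + \<eta>"] \<open>\<eta> > 0\<close>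
  obtain n where n: "measure ?M (?A n) < measure ?M (perp_proj e ` K) + \<eta>"
    by (auto dest: eventually_happens)
  have "measure ?M (outer_part e K \<epsilon>) \<le> measure ?M (?A n)" if "\<epsilon> \<le> 1 / real (Suc n)" for \<epsilon>
    using fin[of "1 / real (Suc n)"] by (intro measure_mono_fmeasurable mono that fmeasurableI) auto
  with n show ?thesis
    by (intro exI[of _ "1 / real (Suc n)"]) (auto intro: order_trans less_imp_le)
qed

lemma inner_part_subset: "\<epsilon> > 0 \<Longrightarrow> inner_part e K \<epsilon> \<subseteq> perp_proj e ` K"
  using height_continuity_set_subset[of e K] by (auto simp: inner_part_def)

text \<open>The inner parts exhaust the continuity set because it is relatively open, and that set
  has the full measure of the projection. Continuity from below gives the claim.\<close>

lemma ex_inner_part_measure_ge: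
  assumes K: "compact K" and unit: "norm e = 1" and "\<eta> > 0"
    and null: "emeasure (perp_lborel e) (closure (dis_ct e K)) = 0"
  shows "\<exists>\<epsilon>0>0. \<forall>\<epsilon>. 0 < \<epsilon> \<and> \<epsilon> \<le> \<epsilon>0 \<longrightarrow>
    measure (perp_lborel e) (perp_proj e ` K) - \<eta> \<le> measure (perp_lborel e) (inner_part e K \<epsilon>)"
proof -
  let ?M = "perp_lborel e" and ?A = "\<lambda>n. inner_part e K (1 / real (Suc n))"
  let ?U = "height_continuity_set e K"
  have mono: "inner_part e K b \<subseteq> inner_part e K a" if "a \<le> b" for a b
    unfolding inner_part_def using that by auto
  have pK: "perp_proj e ` K \<in> sets borel"
    by (intro borel_closed compact_imp_closed compact_perp_proj K)
  have finK: "emeasure ?M (perp_proj e ` K) < \<infinity>"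
    using pK by (intro emeasure_perp_lborel_bounded unit compact_imp_bounded compact_perp_proj K)
  have "(\<Union>n. ?A n) = ?U"
  proof
    show "(\<Union>n. ?A n) \<subseteq> ?U" by (auto simp: inner_part_def)
    show "?U \<subseteq> (\<Union>n. ?A n)"
    proof
      fix y assume y: "y \<in> ?U"
      then obtain a where a: "a > 0" "ball y a \<inter> perp_hyperplane e \<subseteq> ?U"
        using openin_height_continuity_set[of e K] by (auto simp: openin_contains_ball)
      obtain n where "1 / real (Suc n) < a" using nat_approx_posE[OF a(1)] by blast
      then have "y \<in> ?A n"
        using a y openin_imp_subset[OF openin_height_continuity_set[of e K]]
        by (force simp: inner_part_def)
      then show "y \<in> (\<Union>n. ?A n)" by blast
    qed
  qed
  moreover have "(\<lambda>n. measure ?M (?A n)) \<longlonglongrightarrow> measure ?M (\<Union>n. ?A n)"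
  proof (intro Lim_measure_incseq)
    show "incseq ?A"
      by (intro incseq_SucI mono) (simp add: frac_le)
    show "emeasure ?M (\<Union>n. ?A n) \<noteq> \<infinity>"
      using finK unfolding calculation emeasure_height_continuity_set[OF K unit null] by (simp add: less_top)
  qed auto
  moreover have "measure ?M ?U = measure ?M (perp_proj e ` K)"
    unfolding measure_def emeasure_height_continuity_set[OF K unit null] ..
  ultimately have "(\<lambda>n. measure ?M (?A n)) \<longlonglongrightarrow> measure ?M (perp_proj e ` K)" by simp
  from order_tendstoD(1)[OF this, of "measure ?M (perp_proj e ` K) - \<eta>"] \<open>\<eta> > 0\<close>
  obtain n where n: "measure ?M (perp_proj e ` K) - \<eta> < measure ?M (?A n)"
    by (auto dest: eventually_happens)
  have "measure ?M (?A n) \<le> measure ?M (inner_part e K \<epsilon>)" if "0 < \<epsilon>" "\<epsilon> \<le> 1 / real (Suc n)" for \<epsilon>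
  proof (rule measure_mono_fmeasurable[OF mono[OF that(2)]])
    have "emeasure ?M (inner_part e K \<epsilon>) \<le> emeasure ?M (perp_proj e ` K)"
      using pK by (intro emeasure_mono inner_part_subset that) auto
    then show "inner_part e K \<epsilon> \<in> fmeasurable ?M"
      using finK by (intro fmeasurableI) (auto intro: le_less_trans)
  qed auto
  with n show ?thesis
    by (intro exI[of _ "1 / real (Suc n)"]) (auto intro: order_trans less_imp_le)
qed

text \<open>\<open>measure\<close> turns an infinite volume into 0, and the Bochner integral turns a
  non-integrable function into 0. Compactness excludes the first for every path, and the finiteness
  hypothesis excludes the second.\<close>

lemma integral_wiener_sausage_volume:
  fixes X :: "real \<Rightarrow> 'v \<Rightarrow> 'a::euclidean_space"
  assumes bridge: "brownian_bridge M X a b t" and "t > 0" and K: "compact K"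
    and fin: "(\<integral>\<^sup>+\<omega>. emeasure lborel (wiener_sausage K (\<lambda>s. X s \<omega>) t) \<partial>M) < \<infinity>"
  shows "(\<integral>\<^sup>+\<omega>. emeasure lborel (wiener_sausage K (\<lambda>s. X s \<omega>) t) \<partial>M) =
    ennreal (\<integral>\<omega>. measure lborel (wiener_sausage K (\<lambda>s. X s \<omega>) t) \<partial>M)"
proof -
  let ?S = "\<lambda>\<omega>. wiener_sausage K (\<lambda>s. X s \<omega>) t"
  have m: "(\<lambda>\<omega>. emeasure lborel (?S \<omega>)) \<in> borel_measurable M"
    using bridge by (intro wiener_sausage_volume_measurable K \<open>t > 0\<close>) (auto simp: brownian_bridge_def)
  have e: "ennreal (measure lborel (?S \<omega>)) = emeasure lborel (?S \<omega>)" if "\<omega> \<in> space M" for \<omega>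
  proof -
    have "continuous_on {0..t} (\<lambda>s. X s \<omega>)" using bridge that by (simp add: brownian_bridge_def)
    then have "bounded (closed_sausage K (\<lambda>s. X s \<omega>) t)"
      by (intro compact_imp_bounded compact_closed_sausage K)
    then have "bounded (?S \<omega>)"
      by (rule bounded_subset) (auto simp: wiener_sausage_def closed_sausage_def intro: bexI)
    then show ?thesis
      using emeasure_bounded_finite by (intro emeasure_eq_ennreal_measure[symmetric]) (auto simp: less_top)
  qed
  have "(\<integral>\<omega>. measure lborel (?S \<omega>) \<partial>M) = enn2real (\<integral>\<^sup>+\<omega>. ennreal (measure lborel (?S \<omega>)) \<partial>M)"
    using m unfolding measure_def by (intro integral_eq_nn_integral) auto
  also have "(\<integral>\<^sup>+\<omega>. ennreal (measure lborel (?S \<omega>)) \<partial>M) = (\<integral>\<^sup>+\<omega>. emeasure lborel (?S \<omega>) \<partial>M)"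
    by (intro nn_integral_cong e)
  finally show ?thesis using fin by simp
qed

text \<open>Here \<open>x / real N\<close> is the drift per piece. The upper bound comes first, in
  \<open>ennreal\<close>: it provides the finiteness that makes \<open>E\<close> the true
  expectation, which the lower bound then uses.\<close>

lemma wiener_sausage_expectation_bounds:
  fixes X :: "real \<Rightarrow> 'v \<Rightarrow> 'a::euclidean_space"
  assumes bridge: "brownian_bridge M X 0 (x *\<^sub>R e) t" and t: "t > 0" and "N > 0" and x: "x > 0"
    and dim: "DIM('a) \<ge> 2" and unit: "norm e = 1" and K: "compact K" "K \<subseteq> cball 0 R" and R: "R \<ge> 0"
    and \<epsilon>: "0 < \<epsilon>" "\<epsilon> \<le> 1" and \<Lambda>: "2 * (R + 1) \<le> x / real N" "x / real N \<le> \<Lambda>"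
    and \<rho>: "\<rho> = \<epsilon> / (2 * chaining_const (2 * DIM('a)))"
  defines "E \<equiv> \<integral>\<omega>. measure lborel (wiener_sausage K (\<lambda>s. X s \<omega>) t) \<partial>M"
    and "\<gamma> \<equiv> gaussian_moment_const TYPE('a) DIM('a) * (t / real N) ^ DIM('a)"
    and "\<kappa> \<equiv> \<lambda>A. measure (perp_lborel e) A"
  shows "E \<le> \<kappa> (outer_part e K \<epsilon>) * x + real N * (\<kappa> (outer_part e K \<epsilon>) * (2 * (R + 1)) +
      bad_volume_const TYPE('a) (2 * DIM('a)) \<rho> (R + \<Lambda>) * (4 * \<gamma>))" (is "_ \<le> ?up")
    and "\<kappa> (inner_part e K \<epsilon>) * (x - 2 * (R + 1) * real N) * (1 - (4 / \<rho> ^ (2 * DIM('a)) + 2) * \<gamma>) \<le> E"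
proof -
  define \<delta> where "\<delta> = t / real N"
  have \<delta>: "\<delta> > 0" "t = real N * \<delta>" using t \<open>N > 0\<close> by (auto simp: \<delta>_def)
  have v\<delta>: "x / t * \<delta> = x / real N" using t by (simp add: \<delta>_def)
  let ?I = "\<integral>\<^sup>+\<omega>. emeasure lborel (wiener_sausage K (\<lambda>s. X s \<omega>) t) \<partial>M"
  have "?I \<le> ennreal (real N * (\<kappa> (outer_part e K \<epsilon>) * (x / real N + 2 * (R + 1)) +
      bad_volume_const TYPE('a) (2 * DIM('a)) \<rho> (R + \<Lambda>) * (4 * \<gamma>)))"
    using nn_integral_wiener_sausage_le[OF bridge \<delta>(2,1) \<open>N > 0\<close> dim unit K R \<epsilon> less_imp_le[OF x] _ \<rho>, of \<Lambda>] \<Lambda>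
    unfolding v\<delta> \<kappa>_def \<gamma>_def \<delta>_def[symmetric] by (simp add: mult.assoc)
  also have "real N * (\<kappa> (outer_part e K \<epsilon>) * (x / real N + 2 * (R + 1)) +
      bad_volume_const TYPE('a) (2 * DIM('a)) \<rho> (R + \<Lambda>) * (4 * \<gamma>)) = ?up"
    using \<open>N > 0\<close> by (simp add: field_simps)
  finally have up: "?I \<le> ennreal ?up" .
  then have "?I < \<infinity>" by (simp add: le_less_trans)
  then have I: "?I = ennreal E"
    unfolding E_def by (rule integral_wiener_sausage_volume[OF bridge t K(1)])
  have E0: "E \<ge> 0" unfolding E_def by (rule Bochner_Integration.integral_nonneg) simp
  have \<Lambda>0: "\<Lambda> \<ge> 0" using x by (intro order_trans[OF _ \<Lambda>(2)]) simp
  have \<rho>0: "\<rho> > 0" using \<epsilon> chaining_const_pos[of "2 * DIM('a)"] by (simp add: \<rho>)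
  have \<gamma>0: "\<gamma> \<ge> 0" using gaussian_moment_const_nonneg[where 'a='a] t by (simp add: \<gamma>_def)
  have "?up \<ge> 0"
    using \<rho>0 R \<Lambda>0 x \<gamma>0 bad_volume_const_pos[of "2 * DIM('a)" \<rho> "R + \<Lambda>", where 'a='a]
    unfolding \<kappa>_def by (intro add_nonneg_nonneg mult_nonneg_nonneg) auto
  then show "E \<le> ?up" using up unfolding I by (simp add: ennreal_le_iff)
  define V where "V = \<kappa> (inner_part e K \<epsilon>) * (x / real N - 2 * (R + 1))"
  have V0: "V \<ge> 0" using \<Lambda> by (simp add: V_def \<kappa>_def)
  have pK: "perp_proj e ` K \<in> sets borel"
    by (intro borel_closed compact_imp_closed compact_perp_proj K)
  have "emeasure (perp_lborel e) (inner_part e K \<epsilon>) \<le> emeasure (perp_lborel e) (perp_proj e ` K)"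
    using pK by (intro emeasure_mono inner_part_subset \<epsilon>) auto
  also have "\<dots> < \<infinity>"
    using pK by (intro emeasure_perp_lborel_bounded unit compact_imp_bounded compact_perp_proj K)
  finally have "ennreal (real N * V) \<le> ennreal E +
      ennreal (real N * V * (4 / \<rho> ^ (2 * DIM('a)) + 2) * \<gamma>)"
    using nn_integral_wiener_sausage_ge[OF bridge \<delta>(2,1) \<open>N > 0\<close> dim unit K R \<epsilon> _ \<rho>, of V] \<Lambda>
    unfolding v\<delta> \<gamma>_def \<delta>_def[symmetric] I V_def \<kappa>_def by simp
  also have "\<dots> = ennreal (E + real N * V * (4 / \<rho> ^ (2 * DIM('a)) + 2) * \<gamma>)"
    using E0 V0 \<rho>0 \<gamma>0 by (intro ennreal_plus[symmetric]) auto
  finally have "real N * V \<le> E + real N * V * (4 / \<rho> ^ (2 * DIM('a)) + 2) * \<gamma>"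
    using E0 V0 \<rho>0 \<gamma>0 by (subst (asm) ennreal_le_iff) auto
  then have "real N * V * (1 - (4 / \<rho> ^ (2 * DIM('a)) + 2) * \<gamma>) \<le> E"
    by (simp only: right_diff_distrib mult_1_right mult.assoc diff_le_eq)
  moreover have "real N * V = \<kappa> (inner_part e K \<epsilon>) * (x - 2 * (R + 1) * real N)"
    using \<open>N > 0\<close> by (simp add: V_def field_simps)
  ultimately show "\<kappa> (inner_part e K \<epsilon>) * (x - 2 * (R + 1) * real N) * (1 - (4 / \<rho> ^ (2 * DIM('a)) + 2) * \<gamma>) \<le> E"
    by simp
qed

section \<open>The choice of the constants and the limit\<close>

theorem theorem4p3:
  fixes e :: "'a::euclidean_space" and K :: "'a set"
    and P :: "'a \<Rightarrow> 'w measure" and B :: "real \<Rightarrow> 'w \<Rightarrow> 'a"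
    and Q :: "real \<Rightarrow> real \<Rightarrow> 'v measure" and X :: "real \<Rightarrow> real \<Rightarrow> real \<Rightarrow> 'v \<Rightarrow> 'a"
  assumes dim: "DIM('a) \<ge> 2"
    and unit: "norm e = 1"
    and bm: "\<And>y. brownian_motion (P y) B y"
    and bridge: "\<And>x t. x > 0 \<Longrightarrow> t > 0 \<Longrightarrow> brownian_bridge (Q x t) (X x t) 0 (x *\<^sub>R e) t"
    and compact: "compact K"
    and non_polar: "non_polar P B K"
    and regular: "UNIV - Omega_set P B K = regular_points P B K"
    and null: "emeasure (perp_lborel e) (closure (dis_ct e K)) = 0"
  shows "(\<lambda>(x, t). (\<integral>\<omega>. measure lborel (wiener_sausage K (\<lambda>s. X x t s \<omega>) t) \<partial>(Q x t))
                    - measure (perp_lborel e) (perp_proj e ` K) * x)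
           \<in> o[filtercomap (\<lambda>(x, t). x / t) at_top \<sqinter> filtercomap (\<lambda>(x, t). t) at_top](\<lambda>(x, t). x)"
    (is "_ \<in> o[?F](_)")
proof (rule landau_o.smallI)
  fix c0 :: real assume "c0 > 0"
  let ?d = "DIM('a)"
  \<comment> \<open>Each of the two bounds loses \<open>\<eta> * x\<close> three times: for the
    margin \<open>\<epsilon>\<close>, for the ends of the pieces and for the fluctuations.\<close>
  define \<eta> where "\<eta> = c0 / 3"
  have \<eta>: "\<eta> > 0" using \<open>c0 > 0\<close> by (simp add: \<eta>_def)
  define \<kappa> where "\<kappa> A = measure (perp_lborel e) A" for A
  define k where "k = \<kappa> (perp_proj e ` K)"
  have k0: "k \<ge> 0" by (simp add: k_def \<kappa>_def)
  obtain R where R: "R \<ge> 0" "K \<subseteq> cball 0 R"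
  proof -
    obtain r where r: "\<And>y. y \<in> K \<Longrightarrow> norm y \<le> r"
      using compact_imp_bounded[OF compact] unfolding bounded_iff by blast
    show ?thesis by (rule that[of "max 0 r"]) (use r in \<open>auto simp: le_max_iff_disj\<close>)
  qed
  obtain \<epsilon>1 where \<epsilon>1: "\<epsilon>1 > 0" "\<And>\<epsilon>. 0 < \<epsilon> \<Longrightarrow> \<epsilon> \<le> \<epsilon>1 \<Longrightarrow> \<kappa> (outer_part e K \<epsilon>) \<le> k + \<eta>"
    using ex_outer_part_measure_le[OF compact unit \<eta>] unfolding \<kappa>_def k_def by blast
  obtain \<epsilon>2 where \<epsilon>2: "\<epsilon>2 > 0" "\<And>\<epsilon>. 0 < \<epsilon> \<Longrightarrow> \<epsilon> \<le> \<epsilon>2 \<Longrightarrow> k - \<eta> \<le> \<kappa> (inner_part e K \<epsilon>)"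
    using ex_inner_part_measure_ge[OF compact unit \<eta> null] unfolding \<kappa>_def k_def by blast
  define \<epsilon> where "\<epsilon> = min 1 (min \<epsilon>1 \<epsilon>2)"
  have \<epsilon>: "0 < \<epsilon>" "\<epsilon> \<le> 1" using \<epsilon>1 \<epsilon>2 by (auto simp: \<epsilon>_def)
  define ko where "ko = \<kappa> (outer_part e K \<epsilon>)"
  define ki where "ki = \<kappa> (inner_part e K \<epsilon>)"
  have ko: "0 \<le> ko" "ko \<le> k + \<eta>" using \<epsilon>1(2)[of \<epsilon>] \<epsilon> by (auto simp: ko_def \<epsilon>_def \<kappa>_def)
  have pK: "perp_proj e ` K \<in> sets borel"
    by (intro borel_closed compact_imp_closed compact_perp_proj compact)
  have "perp_proj e ` K \<in> fmeasurable (perp_lborel e)"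
    using pK emeasure_perp_lborel_bounded[OF unit pK compact_imp_bounded[OF compact_perp_proj[OF compact]]]
    by (intro fmeasurableI) auto
  then have ki: "0 \<le> ki" "k - \<eta> \<le> ki" "ki \<le> k"
    using \<epsilon>2(2)[of \<epsilon>] \<epsilon> measure_mono_fmeasurable[OF inner_part_subset[OF \<epsilon>(1), of e K]]
    by (auto simp: ki_def k_def \<epsilon>_def \<kappa>_def)
  \<comment> \<open>\<open>a\<close> is the length gained or lost at the two ends of a piece, and
    \<open>L\<close> will be the least drift per piece. The second entry of the maximum makes the
    end effects at most \<open>\<eta> * L\<close> per piece.\<close>
  define a where "a = 2 * (R + 1)"
  define L where "L = max a (a * (k + \<eta>) / \<eta>)"
  have a0: "a > 0" using R by (simp add: a_def)
  have L: "L > 0" "a \<le> L" using a0 by (auto simp: L_def)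
  have "a * (k + \<eta>) / \<eta> \<le> L" by (simp add: L_def)
  then have aL: "a * (k + \<eta>) \<le> \<eta> * L"
    using \<eta> by (simp add: divide_le_eq mult.commute)
  define \<rho> where "\<rho> = \<epsilon> / (2 * chaining_const (2 * ?d))"
  define C where "C = bad_volume_const TYPE('a) (2 * ?d) \<rho> (R + 2 * L)"
  define G where "G = gaussian_moment_const TYPE('a) ?d"
  define H where "H = 4 / \<rho> ^ (2 * ?d) + 2"
  have \<rho>0: "\<rho> > 0" using \<epsilon> chaining_const_pos[of "2 * ?d"] by (simp add: \<rho>_def)
  have C0: "C \<ge> 0" using bad_volume_const_pos[of "2 * ?d" \<rho> "R + 2 * L", where 'a='a] \<rho>0 R L
    by (simp add: C_def)
  have G0: "G \<ge> 0" by (simp add: G_def gaussian_moment_const_nonneg)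
  have H0: "H \<ge> 0" using \<rho>0 by (simp add: H_def)
  \<comment> \<open>A drift of at most \<open>2 * L\<close> per piece means a duration of at most
    \<open>2 * L / v\<close> with \<open>v = x / t\<close>. The three entries make this duration at
    most 1, the expected cost of wild pieces in the upper bound at most \<open>\<eta> * L\<close>
    per piece, and the fluctuation loss in the lower bound at most
    \<open>\<eta> * x\<close>.\<close>
  define v0 where "v0 = max (2 * L) (max (2 * L * (4 * C * G) / (\<eta> * L)) (2 * L * (k * H * G) / \<eta>))"
  have key: "\<bar>(\<integral>\<omega>. measure lborel (wiener_sausage K (\<lambda>s. X x t s \<omega>) t) \<partial>(Q x t)) - k * x\<bar> \<le> c0 * x \<and> x > 0"
    if v: "v0 \<le> x / t" and t: "1 \<le> t" for x t
  proof -
    define v where "v = x / t"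
    have v: "2 * L \<le> v" "2 * L * (4 * C * G) \<le> v * (\<eta> * L)" "2 * L * (k * H * G) \<le> v * \<eta>"
      using v \<eta> L by (auto simp: v0_def v_def[symmetric] divide_le_eq)
    then have v0: "v > 0" using L by linarith
    have x: "x = v * t" using t by (simp add: v_def)
    \<comment> \<open>With \<open>t >= 1\<close> the bound on the speed becomes
      \<open>x >= 2 * L\<close>, so \<open>x\<close> is positive and there is at least one
      piece.\<close>
    have "2 * L * 1 \<le> v * t" using v t v0 L by (intro mult_mono) auto
    then have xL: "2 * L \<le> x" by (simp add: x)
    then have x0: "x > 0" using L by linarith
    \<comment> \<open>Rounding down makes the drift per piece at least \<open>L\<close>; since
      \<open>N >= 1\<close>, it is also at most \<open>2 * L\<close>.\<close>
    define N where "N = nat \<lfloor>x / L\<rfloor>"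
    have "2 \<le> x / L" using xL L by (simp add: le_divide_eq)
    then have N: "real N \<le> x / L" "x / L < real N + 1" "1 \<le> real N"
      unfolding N_def by linarith+
    then have N0: "N > 0" by simp
    have NL: "real N * L \<le> x" using N(1) L by (simp add: le_divide_eq)
    have "x < (real N + 1) * L" using N(2) L by (simp add: divide_less_eq)
    also have "\<dots> \<le> 2 * L * real N" using N(3) L by (simp add: algebra_simps)
    finally have xN: "L \<le> x / real N" "x / real N \<le> 2 * L"
      using NL N0 by (auto simp: field_simps)
    have \<delta>: "0 \<le> t / real N" "t / real N \<le> 2 * L / v"
      using xN(2) v0 t N0 by (auto simp: x field_simps)
    define \<gamma> where "\<gamma> = G * (t / real N) ^ ?d"
    have \<gamma>: "0 \<le> \<gamma>" "\<gamma> \<le> G * (2 * L / v)"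
    proof -
      show "0 \<le> \<gamma>" using G0 \<delta> by (simp add: \<gamma>_def)
      have "t / real N \<le> 1" using \<delta> v v0 by (auto intro: order_trans)
      \<comment> \<open>For a duration of at most 1 the power \<open>d\<close> may be lowered to 1,
        so conditions linear in \<open>v\<close> suffice in \<open>v0\<close>.\<close>
      then have "(t / real N) ^ ?d \<le> (t / real N) ^ 1" using \<delta> dim by (intro power_decreasing) auto
      then show "\<gamma> \<le> G * (2 * L / v)"
        unfolding \<gamma>_def using \<delta> G0 by (intro mult_left_mono) auto
    qed
    define E where "E = (\<integral>\<omega>. measure lborel (wiener_sausage K (\<lambda>s. X x t s \<omega>) t) \<partial>(Q x t))"
    have t0: "t > 0" using t by simp
    have "a \<le> x / real N" using xN(1) L(2) by linarith
    note bnds = wiener_sausage_expectation_bounds[OF bridge[OF x0 t0] t0 N0 x0 dim unit compact R(2,1) \<epsilon>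
        this[unfolded a_def] xN(2) \<rho>_def, folded \<kappa>_def E_def G_def C_def H_def a_def,
        folded ko_def ki_def \<gamma>_def]
    have "C * (4 * \<gamma>) = 4 * C * \<gamma>" by simp
    also have "\<dots> \<le> 4 * C * (G * (2 * L / v))"
      using C0 by (intro mult_left_mono \<gamma>) simp
    also have "\<dots> \<le> \<eta> * L" using v(2) v0 by (simp add: field_simps)
    finally have CL: "C * (4 * \<gamma>) \<le> \<eta> * L" .
    have "a * ko \<le> a * (k + \<eta>)" using a0 by (intro mult_left_mono ko) simp
    then have "ko * a \<le> \<eta> * L" using aL by (simp only: mult.commute[of ko])
    then have "real N * (ko * a + C * (4 * \<gamma>)) \<le> real N * (2 * \<eta> * L)"
      using CL by (intro mult_left_mono) auto
    also have "\<dots> \<le> 2 * \<eta> * x"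
      using mult_left_mono[OF NL, of "2 * \<eta>"] \<eta> by (simp add: ac_simps)
    finally have "E \<le> ko * x + 2 * \<eta> * x" using bnds(1) by linarith
    also have "\<dots> \<le> (k + \<eta>) * x + 2 * \<eta> * x" using ko x0 by (intro add_right_mono mult_right_mono) auto
    finally have upper: "E \<le> k * x + 3 * \<eta> * x" by (simp add: algebra_simps)
    have "real N * a \<le> real N * L" using L(2) by (intro mult_left_mono) auto
    then have aN: "a * real N \<le> x" using NL by (simp only: mult.commute[of a])
    have "ki * (a * real N) \<le> k * (a * real N)"
      using ki a0 by (intro mult_right_mono) auto
    also have "\<dots> \<le> \<eta> * L * real N"
    proof -
      have "a * k \<le> a * (k + \<eta>)" using a0 \<eta> by (intro mult_left_mono) auto
      then have "a * k \<le> \<eta> * L" using aL by (rule order_trans)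
      then have "a * k * real N \<le> \<eta> * L * real N" by (intro mult_right_mono) simp_all
      then show ?thesis by (simp only: ac_simps)
    qed
    also have "\<dots> \<le> \<eta> * x"
      using mult_left_mono[OF NL less_imp_le[OF \<eta>]] by (simp only: ac_simps)
    finally have l1: "ki * (a * real N) \<le> \<eta> * x" .
    have "ki * (x - a * real N) * (H * \<gamma>) \<le> k * x * (H * (G * (2 * L / v)))"
      using ki k0 x0 aN a0 H0 \<gamma> by (intro mult_mono mult_left_mono) auto
    also have "\<dots> \<le> \<eta> * x"
    proof -
      have "k * (H * (G * (2 * L / v))) \<le> \<eta>" using v(3) v0 by (simp add: field_simps)
      then have "k * (H * (G * (2 * L / v))) * x \<le> \<eta> * x" using x0 by (intro mult_right_mono) auto
      then show ?thesis by (simp only: ac_simps)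
    qed
    finally have l2: "ki * (x - a * real N) * (H * \<gamma>) \<le> \<eta> * x" .
    have "(k - \<eta>) * x \<le> ki * x" using ki x0 by (intro mult_right_mono) auto
    then have "k * x - 3 * \<eta> * x \<le> ki * x - ki * (a * real N) - ki * (x - a * real N) * (H * \<gamma>)"
      using l1 l2 by (simp add: algebra_simps)
    also have "\<dots> = ki * (x - a * real N) * (1 - H * \<gamma>)" by (simp add: algebra_simps)
    also have "\<dots> \<le> E" by (rule bnds(2))
    finally have "k * x - 3 * \<eta> * x \<le> E" .
    with upper show ?thesis using x0 by (simp add: E_def \<eta>_def abs_le_iff)
  qed
  have "eventually (\<lambda>z. case z of (x, t) \<Rightarrow> v0 \<le> x / t) (filtercomap (\<lambda>(x, t). x / t) at_top)"
    by (rule eventually_filtercomapI[OF eventually_ge_at_top[of v0], THEN eventually_mono]) auto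
  then have e1: "eventually (\<lambda>z. case z of (x, t) \<Rightarrow> v0 \<le> x / t) ?F"
    by (rule filter_leD[OF inf_le1])
  have "eventually (\<lambda>z. case z of (x, t) \<Rightarrow> 1 \<le> t) (filtercomap (\<lambda>(x::real, t::real). t) at_top)"
    by (rule eventually_filtercomapI[OF eventually_ge_at_top[of 1], THEN eventually_mono]) auto
  then have e2: "eventually (\<lambda>z::real \<times> real. case z of (x, t) \<Rightarrow> 1 \<le> t) ?F"
    by (rule filter_leD[OF inf_le2])
  show "eventually (\<lambda>z. norm (case z of (x, t) \<Rightarrow>
      (\<integral>\<omega>. measure lborel (wiener_sausage K (\<lambda>s. X x t s \<omega>) t) \<partial>(Q x t))
      - measure (perp_lborel e) (perp_proj e ` K) * x) \<le> c0 * norm (case z of (x, t) \<Rightarrow> x)) ?F"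
    using e1 e2
  proof eventually_elim
    case (elim z)
    then show ?case using key[of "fst z" "snd z"] by (simp add: k_def \<kappa>_def split_beta)
  qed
qed

end
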